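(* Let $K\in L_2(\mathbb R)$ be a kernel (satisfying the standing assumptions below) with $S_K=T_K$, and let $f\in L_2(\mathbb R)$ be a probability density. Then $\Phi(n,f,K)$ is of exact order $n^{-1}$ if and only if $S_K>0$ and $D_f<\infty$.
   Context: A kernel is an integrable function $K:\mathbb R\to\mathbb R$ with $\int K=1$; standing assumptions: $K$ is bounded, continuous at $0$, and $\int K^2<2K(0)$. For a sample $X_1,\dots,X_n$ i.i.d. with density $f$, bandwidth $h>0$, $f_{n,K,h}(x)=\frac1n\sum_{i=1}^n K_h(x-X_i)$ with $K_h(x)=K(x/h)/h$. $\mathrm{MISE}_f(f_{n,K,h})=E_f\int (f_{n,K,h}-f)^2$, and $\Phi(n,f,K)=\min_{h>0}\mathrm{MISE}_f(f_{n,K,h})$. $\varphi_K(t)=\int e^{itx}K(x)dx$ and $\varphi_f(t)=\int e^{itx}f(x)dx$. $S_K=\inf\{t\ge0: |\varphi_K(t)-1|\ne0\}$, $T_K=\inf\{r\ge0: |\varphi_K(t)-1|\ne0 \text{ for a.e. } t\ge r\}$, $D_f=\sup\{t\ge0:\varphi_f(t)\ne0\}$. "Exact order $n^{-1}$" means there exist $0<c\le C<\infty$ and $n_0$ with $c/n\le\Phi(n,f,K)\le C/n$ for all $n\ge n_0$. *)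

theory Defs
  imports "HOL-Probability.Probability"
begin

definition is_kernel :: "(real \<Rightarrow> real) \<Rightarrow> bool" where
  "is_kernel K \<longleftrightarrow>
     integrable lborel K \<and> integral\<^sup>L lborel K = 1 \<and>
     (\<exists>B. \<forall>x. \<bar>K x\<bar> \<le> B) \<and> isCont K 0 \<and>
     integrable lborel (\<lambda>x. (K x)\<^sup>2) \<and>
     integral\<^sup>L lborel (\<lambda>x. (K x)\<^sup>2) < 2 * K 0"

definition is_density :: "(real \<Rightarrow> real) \<Rightarrow> bool" where
  "is_density f \<longleftrightarrow> f \<in> borel_measurable borel \<and> (\<forall>x. 0 \<le> f x) \<and>
     integrable lborel f \<and> integral\<^sup>L lborel f = 1"

definition fourier :: "(real \<Rightarrow> real) \<Rightarrow> real \<Rightarrow> complex" where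
  "fourier g t = integral\<^sup>L lborel (\<lambda>x. cis (t * x) * complex_of_real (g x))"

definition scaled_kernel :: "(real \<Rightarrow> real) \<Rightarrow> real \<Rightarrow> real \<Rightarrow> real" where
  "scaled_kernel K h x = K (x / h) / h"

definition kde :: "nat \<Rightarrow> (real \<Rightarrow> real) \<Rightarrow> real \<Rightarrow> (nat \<Rightarrow> real) \<Rightarrow> real \<Rightarrow> real" where
  "kde n K h X x = (\<Sum>i<n. scaled_kernel K h (x - X i)) / real n"

definition sample_law :: "nat \<Rightarrow> (real \<Rightarrow> real) \<Rightarrow> (nat \<Rightarrow> real) measure" where
  "sample_law n f = PiM {..<n} (\<lambda>_. density lborel f)"

definition MISE :: "nat \<Rightarrow> (real \<Rightarrow> real) \<Rightarrow> (real \<Rightarrow> real) \<Rightarrow> real \<Rightarrow> ennreal" where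
  "MISE n f K h = (\<integral>\<^sup>+ X. (\<integral>\<^sup>+ x. ennreal ((kde n K h X x - f x)\<^sup>2) \<partial>lborel) \<partial>sample_law n f)"

definition Phi :: "nat \<Rightarrow> (real \<Rightarrow> real) \<Rightarrow> (real \<Rightarrow> real) \<Rightarrow> ennreal" where
  "Phi n f K = (INF h\<in>{0<..}. MISE n f K h)"

definition S_K :: "(real \<Rightarrow> real) \<Rightarrow> ereal" where
  "S_K K = Inf (ereal ` {t. 0 \<le> t \<and> cmod (fourier K t - 1) \<noteq> 0})"

definition T_K :: "(real \<Rightarrow> real) \<Rightarrow> ereal" where
  "T_K K = Inf (ereal ` {r. 0 \<le> r \<and> (AE t in lborel. r \<le> t \<longrightarrow> cmod (fourier K t - 1) \<noteq> 0)})"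

definition D_f :: "(real \<Rightarrow> real) \<Rightarrow> ereal" where
  "D_f f = Sup (ereal ` {t. 0 \<le> t \<and> fourier f t \<noteq> 0})"

definition exact_order_inv_n :: "(nat \<Rightarrow> ennreal) \<Rightarrow> bool" where
  "exact_order_inv_n P \<longleftrightarrow> (\<exists>c C n0. 0 < c \<and> c \<le> C \<and>
     (\<forall>n\<ge>n0. ennreal (c / real n) \<le> P n \<and> P n \<le> ennreal (C / real n)))"

end

theory Submission
  imports Defs
begin

text \<open>
  Write \<open>\<mu>\<close> for the law of one observation, \<open>m\<^sub>h = K\<^sub>h * f\<close> for the mean of the estimator,
  \<open>V(h)\<close> for its integrated variance with one observation and \<open>E(h) = \<parallel>m\<^sub>h - f\<parallel>\<^sup>2\<close>. Then
  \<open>MISE = V(h) / n + E(h)\<close> with \<open>V(h) = \<parallel>K\<parallel>\<^sup>2 / h - \<parallel>m\<^sub>h\<parallel>\<^sup>2 \<ge> 0\<close>. If \<open>E(h\<^sub>n)\<close> tends to 0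
  while \<open>V(h\<^sub>n)\<close> stays bounded, then \<open>h\<^sub>n\<close> stays in a compact subset of the positive
  half-line: small bandwidths make \<open>V\<close> large, and large ones make \<open>m\<^sub>h\<close> vanish in \<open>L\<^sup>2\<close>.

  Plancherel's theorem is replaced by pairing with a bounded continuous test function \<open>g\<close>. By
  Cauchy-Schwarz, \<open>\<langle>m\<^sub>h - f, g\<rangle>\<^sup>2 \<le> E(h) \<parallel>g\<parallel>\<^sup>2\<close> and the variance under \<open>\<mu>\<close> of
  \<open>y \<mapsto> \<integral> K(u) g(y + h u) du\<close> is at most \<open>V(h) \<parallel>g\<parallel>\<^sup>2\<close>. Taking truncated sines and cosines for
  \<open>g\<close>, a limit \<open>h\<close> of bandwidths with \<open>E(h\<^sub>n) \<rightarrow> 0\<close> satisfies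
  \<open>\<phi>\<^sub>K(h t) \<phi>\<^sub>f(t) = \<phi>\<^sub>f(t)\<close> for all \<open>t\<close>, which yields the necessity of both conditions. The
  variance bound shows that \<open>V(h\<^sub>n) \<rightarrow> 0\<close> would make \<open>cis(t y)\<close> almost surely constant for some
  \<open>t \<noteq> 0\<close>, so \<open>V + E\<close> is bounded away from 0: this is the lower bound of order
  \<open>1 / n\<close>. Conversely, if \<open>\<phi>\<^sub>K = 1\<close> on \<open>[0, s]\<close> and \<open>\<phi>\<^sub>f = 0\<close> beyond \<open>d\<close>, uniqueness of Fourier transforms gives \<open>E(s / d) = 0\<close>.
\<close>

subsection \<open>Square integrability and Fourier transforms\<close>

lemma integrable_mult_of_squares:
  fixes a b :: "'a \<Rightarrow> real"
  assumes [measurable]: "a \<in> borel_measurable M" "b \<in> borel_measurable M"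
    and a: "integrable M (\<lambda>x. (a x)\<^sup>2)" and b: "integrable M (\<lambda>x. (b x)\<^sup>2)"
  shows "integrable M (\<lambda>x. a x * b x)"
proof (rule Bochner_Integration.integrable_bound)
  show "integrable M (\<lambda>x. (a x)\<^sup>2 + (b x)\<^sup>2)"
    using a b by simp
  have "\<bar>p * q\<bar> \<le> p\<^sup>2 + q\<^sup>2" for p q :: real
  proof -
    have "0 \<le> (\<bar>p\<bar> - \<bar>q\<bar>)\<^sup>2" by simp
    then have "2 * (\<bar>p\<bar> * \<bar>q\<bar>) \<le> p\<^sup>2 + q\<^sup>2"
      by (simp add: power2_diff)
    moreover have "0 \<le> \<bar>p\<bar> * \<bar>q\<bar>" by simp
    ultimately show ?thesis unfolding abs_mult by linarith
  qed
  then show "AE x in M. norm (a x * b x) \<le> norm ((a x)\<^sup>2 + (b x)\<^sup>2)"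
    by simp
qed simp

text \<open>Cauchy-Schwarz: the integral of \<open>(l * a x + b x)\<^sup>2\<close> is a nonnegative
  quadratic polynomial in \<open>l\<close>, to be evaluated at its minimiser.\<close>

lemma square_integral_mult_le:
  fixes a b :: "'a \<Rightarrow> real"
  assumes [measurable]: "a \<in> borel_measurable M" "b \<in> borel_measurable M"
    and a: "integrable M (\<lambda>x. (a x)\<^sup>2)" and b: "integrable M (\<lambda>x. (b x)\<^sup>2)"
  shows "(\<integral>x. a x * b x \<partial>M)\<^sup>2 \<le> (\<integral>x. (a x)\<^sup>2 \<partial>M) * (\<integral>x. (b x)\<^sup>2 \<partial>M)"
proof -
  define A B C where "A = (\<integral>x. (a x)\<^sup>2 \<partial>M)" and "B = (\<integral>x. (b x)\<^sup>2 \<partial>M)"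
    and "C = (\<integral>x. a x * b x \<partial>M)"
  note ab = integrable_mult_of_squares[OF assms]
  have quad: "0 \<le> l\<^sup>2 * A + 2 * l * C + B" for l
  proof -
    have "0 \<le> (\<integral>x. (l * a x + b x)\<^sup>2 \<partial>M)" by simp
    also have "(\<integral>x. (l * a x + b x)\<^sup>2 \<partial>M) = (\<integral>x. l\<^sup>2 * (a x)\<^sup>2 + 2 * l * (a x * b x) + (b x)\<^sup>2 \<partial>M)"
      by (simp add: power2_sum power_mult_distrib algebra_simps)
    also have "\<dots> = l\<^sup>2 * A + 2 * l * C + B"
      using a b ab by (simp add: A_def B_def C_def)
    finally show ?thesis .
  qed
  have "0 \<le> A" "0 \<le> B" by (simp_all add: A_def B_def)
  have "C\<^sup>2 \<le> A * B"
  proof (cases "A = 0")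
    case True
    have "C = 0"
    proof (rule ccontr)
      assume "C \<noteq> 0"
      \<comment> \<open>At this \<open>l\<close> the polynomial, which is affine because
        \<open>A = 0\<close>, takes the value -1.\<close>
      then show False
        using quad[of "- (B + 1) / (2 * C)"] True by (simp add: field_simps)
    qed
    then show ?thesis using True by simp
  next
    case False
    with \<open>0 \<le> A\<close> have "A > 0" by simp
    then show ?thesis
      using quad[of "- C / A"] by (simp add: field_simps power2_eq_square)
  qed
  then show ?thesis by (simp add: A_def B_def C_def)
qed

text \<open>The integrands of the two sides differ by the square of \<open>a x - 2 * b x\<close>.
  The bound is later applied to the mean and \<open>f\<close> in both orders.\<close>

lemma square_sum_integral_le:
  fixes a b :: "'a \<Rightarrow> real"
  assumes [measurable]: "a \<in> borel_measurable M" "b \<in> borel_measurable M"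
    and a: "integrable M (\<lambda>x. (a x)\<^sup>2)" and b: "integrable M (\<lambda>x. (b x)\<^sup>2)"
  shows "(\<integral>x. (a x)\<^sup>2 \<partial>M) \<le> 2 * (\<integral>x. (a x - b x)\<^sup>2 \<partial>M) + 2 * (\<integral>x. (b x)\<^sup>2 \<partial>M)"
proof -
  note ab = integrable_mult_of_squares[OF assms]
  have d: "integrable M (\<lambda>x. (a x - b x)\<^sup>2)"
    using a b ab by (simp add: power2_diff mult.assoc)
  have "p\<^sup>2 \<le> 2 * (p - q)\<^sup>2 + 2 * q\<^sup>2" for p q :: real
    using zero_le_power2[of "p - 2 * q"] by (simp add: power2_eq_square algebra_simps)
  then have "(\<integral>x. (a x)\<^sup>2 \<partial>M) \<le> (\<integral>x. 2 * (a x - b x)\<^sup>2 + 2 * (b x)\<^sup>2 \<partial>M)"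
    using a b d by (intro integral_mono) auto
  also have "\<dots> = 2 * (\<integral>x. (a x - b x)\<^sup>2 \<partial>M) + 2 * (\<integral>x. (b x)\<^sup>2 \<partial>M)"
    using b d by simp
  finally show ?thesis .
qed

lemma (in prob_space) integrable_bounded:
  fixes Z :: "'a \<Rightarrow> 'b :: {banach, second_countable_topology}"
  assumes "Z \<in> borel_measurable M" "\<And>x. norm (Z x) \<le> B"
  shows "integrable M Z"
  by (rule integrable_const_bound[of _ B]) (use assms in auto)

text \<open>Bias-variance decomposition about \<open>a\<close>: centred summands at distinct
  coordinates are independent, so the cross terms integrate to 0. The nonnegative integral matches
  the form of \<open>MISE\<close>.\<close>

lemma (in prob_space) nn_integral_PiM_sample_mean:
  fixes Z :: "'a \<Rightarrow> real"
  assumes [measurable]: "Z \<in> borel_measurable M" and B: "\<And>x. \<bar>Z x\<bar> \<le> B" and n: "0 < n"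
  shows "(\<integral>\<^sup>+ X. ennreal (((\<Sum>i<n. Z (X i)) / real n - a)\<^sup>2) \<partial>PiM {..<n} (\<lambda>_. M)) =
    ennreal ((expectation (\<lambda>y. (Z y)\<^sup>2) - (expectation Z)\<^sup>2) / real n + (expectation Z - a)\<^sup>2)"
proof -
  let ?P = "PiM {..<n} (\<lambda>_. M)"
  interpret P: product_prob_space "\<lambda>_. M" "{..<n}"
    by (intro product_prob_spaceI) (rule prob_space_axioms)
  define e W where "e = expectation Z" and "W = (\<lambda>y. Z y - e)"
  have Wm [measurable]: "W \<in> borel_measurable M"
    unfolding W_def by simp
  have Wb: "\<bar>W y\<bar> \<le> B + \<bar>e\<bar>" for y
    using B[of y] unfolding W_def by linarith
  have intZ: "integrable M Z"
    by (rule integrable_bounded[of _ B]) (use B in auto)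
  have intZ2: "integrable M (\<lambda>y. (Z y)\<^sup>2)"
    by (rule integrable_bounded[of _ "B\<^sup>2"])
      (use B in \<open>auto simp: abs_le_square_iff[symmetric] intro: order_trans[OF _ abs_ge_self]\<close>)
  have intW: "integrable M W" unfolding W_def using intZ by simp
  have intW2: "integrable M (\<lambda>y. (W y)\<^sup>2)"
    unfolding W_def power2_diff using intZ intZ2 by simp
  have EW: "expectation W = 0"
    unfolding W_def using intZ by (simp add: e_def prob_space)
  have EW2: "expectation (\<lambda>y. (W y)\<^sup>2) = expectation (\<lambda>y. (Z y)\<^sup>2) - e\<^sup>2"
    unfolding W_def power2_diff using intZ intZ2
    by (simp add: prob_space power2_eq_square) (simp add: e_def[symmetric])
  have comp: "(\<integral>X. g (X i) \<partial>?P) = expectation g" if "g \<in> borel_measurable M" "i < n" for g :: "'a \<Rightarrow> real" and i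
    using that distr_PiM_component[of "{..<n}" "\<lambda>_. M" i] prob_space_axioms
    by (subst integral_distr[symmetric, of "\<lambda>X. X i" ?P M g]) auto
  have cross: "(\<integral>X. W (X i) * W (X j) \<partial>?P) = (if i = j then expectation (\<lambda>y. (W y)\<^sup>2) else 0)"
    if ij: "i < n" "j < n" for i j
  proof (cases "i = j")
    case True
    then show ?thesis using comp[of "\<lambda>y. (W y)\<^sup>2" i] ij by (simp add: power2_eq_square)
  next
    case False
    \<comment> \<open>Padding with the constant 1 gives a product over all coordinates, whose
      integral factorises on the product space.\<close>
    let ?g = "\<lambda>l. if l = i \<or> l = j then W else (\<lambda>_. 1)"
    have split: "{..<n} = insert i (insert j ({..<n} - {i, j}))"
      using ij by auto
    have "(\<Prod>l<n. ?g l (X l)) = W (X i) * W (X j)" for X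
      using False by (subst split) (auto simp: prod.insert_if intro: prod.neutral)
    then have "(\<integral>X. W (X i) * W (X j) \<partial>?P) = (\<integral>X. (\<Prod>l<n. ?g l (X l)) \<partial>?P)"
      by simp
    also have "\<dots> = (\<Prod>l<n. expectation (?g l))"
      by (rule P.product_integral_prod) (use intW in auto)
    also have "\<dots> = 0"
      using ij EW by (intro prod_zero) auto
    finally show ?thesis using False by simp
  qed
  have Wi: "(\<lambda>X. W (X i)) \<in> borel_measurable ?P" if "i < n" for i
    using that by (intro measurable_compose[OF _ Wm] measurable_component_singleton) simp
  have intc: "integrable ?P (\<lambda>X. W (X i) * W (X j))" if "i < n" "j < n" for i j
  proof (rule P.P.integrable_bounded)
    show "norm (W (X i) * W (X j)) \<le> (B + \<bar>e\<bar>) * (B + \<bar>e\<bar>)" for X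
      using mult_mono'[OF Wb[of "X i"] Wb[of "X j"]] by (simp add: abs_mult)
  qed (use that Wi in simp)
  have intw: "integrable ?P (\<lambda>X. W (X i))" if "i < n" for i
    by (rule P.P.integrable_bounded[of _ "B + \<bar>e\<bar>"]) (use that Wi Wb in auto)
  define S where "S = (\<lambda>X. \<Sum>i<n. W (X i))"
  have S2: "(S X)\<^sup>2 = (\<Sum>i<n. \<Sum>j<n. W (X i) * W (X j))" for X
    by (simp add: S_def power2_eq_square sum_product)
  have intS: "integrable ?P S" unfolding S_def by (intro Bochner_Integration.integrable_sum) (simp add: intw)
  have intS2: "integrable ?P (\<lambda>X. (S X)\<^sup>2)" unfolding S2 by (intro Bochner_Integration.integrable_sum) (simp add: intc)
  have ES: "(\<integral>X. S X \<partial>?P) = 0"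
    unfolding S_def using intw comp[OF Wm] EW by (simp add: Bochner_Integration.integral_sum)
  have ES2: "(\<integral>X. (S X)\<^sup>2 \<partial>?P) = real n * expectation (\<lambda>y. (W y)\<^sup>2)"
  proof -
    have "(\<integral>X. (S X)\<^sup>2 \<partial>?P) = (\<Sum>i<n. \<Sum>j<n. \<integral>X. W (X i) * W (X j) \<partial>?P)"
      unfolding S2 using intc by (subst Bochner_Integration.integral_sum;
        (intro Bochner_Integration.integrable_sum sum.cong refl Bochner_Integration.integral_sum)?) auto
    also have "\<dots> = (\<Sum>i<n. \<Sum>j<n. if i = j then expectation (\<lambda>y. (W y)\<^sup>2) else 0)"
      by (intro sum.cong refl cross) auto
    finally show ?thesis by simp
  qed
  have eq: "((\<Sum>i<n. Z (X i)) / real n - a)\<^sup>2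
      = (S X)\<^sup>2 / (real n)\<^sup>2 + 2 * ((e - a) / real n) * S X + (e - a)\<^sup>2" for X
  proof -
    have *: "(\<Sum>i<n. Z (X i)) / real n - a = S X / real n + (e - a)"
      using n by (simp add: S_def W_def sum_subtractf field_simps)
    show ?thesis unfolding * power2_sum power_divide by simp
  qed
  have "(\<integral>X. ((\<Sum>i<n. Z (X i)) / real n - a)\<^sup>2 \<partial>?P)
      = real n * expectation (\<lambda>y. (W y)\<^sup>2) / (real n)\<^sup>2 + (e - a)\<^sup>2"
    unfolding eq using intS intS2 by (simp add: ES ES2 P.P.prob_space)
  also have "\<dots> = (expectation (\<lambda>y. (Z y)\<^sup>2) - e\<^sup>2) / real n + (e - a)\<^sup>2"
    unfolding EW2 using n by (simp add: power2_eq_square)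
  finally have "(\<integral>X. ((\<Sum>i<n. Z (X i)) / real n - a)\<^sup>2 \<partial>?P)
      = (expectation (\<lambda>y. (Z y)\<^sup>2) - (expectation Z)\<^sup>2) / real n + (expectation Z - a)\<^sup>2"
    by (simp add: e_def)
  moreover have "integrable ?P (\<lambda>X. ((\<Sum>i<n. Z (X i)) / real n - a)\<^sup>2)"
    unfolding eq using intS intS2 by simp
  ultimately show ?thesis
    by (subst nn_integral_eq_integral) auto
qed

section \<open>Fourier transforms of integrable functions\<close>

lemma borel_measurable_cis [measurable]: "cis \<in> borel_measurable borel"
  by (intro borel_measurable_continuous_onI continuous_intros)

lemma integrable_fourier:
  assumes g: "integrable lborel g"
  shows "integrable lborel (\<lambda>x. cis (t * x) * complex_of_real (g x))"
proof (rule Bochner_Integration.integrable_bound[OF g])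
  have [measurable]: "g \<in> borel_measurable borel" using g by auto
  show "(\<lambda>x. cis (t * x) * complex_of_real (g x)) \<in> borel_measurable lborel"
    by simp
qed (simp add: norm_mult)

text \<open>The positive and negative parts of \<open>u\<close> have equal transforms, hence at
  \<open>t = 0\<close> equal mass \<open>c\<close>. If \<open>c = 0\<close>, both vanish; otherwise
  division by \<open>c\<close> gives two densities with the same characteristic function, and Levy's
  uniqueness theorem identifies them.\<close>

lemma AE_eq_0_of_fourier_eq_0:
  assumes u: "integrable lborel u" and F: "\<And>t. fourier u t = 0"
  shows "AE x in lborel. u x = 0"
proof -
  have [measurable]: "u \<in> borel_measurable borel" using u by auto
  define p q where "p = (\<lambda>x. max 0 (u x))" and "q = (\<lambda>x. max 0 (- u x))"
  have [measurable]: "p \<in> borel_measurable borel" "q \<in> borel_measurable borel"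
    unfolding p_def q_def by simp_all
  have ip: "integrable lborel p" and iq: "integrable lborel q"
    unfolding p_def q_def using u by auto
  have upq: "u x = p x - q x" and nn: "0 \<le> p x" "0 \<le> q x" for x
    by (auto simp: p_def q_def)
  have Fpq: "fourier p t = fourier q t" for t
  proof -
    have "fourier u t = fourier p t - fourier q t"
      unfolding fourier_def
      by (subst Bochner_Integration.integral_diff[symmetric])
        (simp_all add: integrable_fourier ip iq upq right_diff_distrib)
    then show ?thesis using F by simp
  qed
  have F0: "fourier g 0 = complex_of_real (integral\<^sup>L lborel g)" for g
    by (simp add: fourier_def)
  define c where "c = integral\<^sup>L lborel p"
  have cq: "integral\<^sup>L lborel q = c"
    using Fpq[of 0] by (simp add: F0 c_def)
  have "0 \<le> c" using nn by (simp add: c_def)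
  show ?thesis
  proof (cases "c = 0")
    case True
    then have "AE x in lborel. p x = 0" "AE x in lborel. q x = 0"
      using integral_nonneg_eq_0_iff_AE[OF ip] integral_nonneg_eq_0_iff_AE[OF iq] nn cq c_def by auto
    then show ?thesis by eventually_elim (simp add: upq)
  next
    case False
    with \<open>0 \<le> c\<close> have c: "c > 0" by simp
    define D where "D = (\<lambda>(g :: real \<Rightarrow> real) x. ennreal (g x / c))"
    have rd: "real_distribution (density lborel (D g))"
      if g: "integrable lborel g" "\<And>x. 0 \<le> g x" "integral\<^sup>L lborel g = c" for g
    proof -
      have "emeasure (density lborel (D g)) (space (density lborel (D g))) = (\<integral>\<^sup>+x. ennreal (g x / c) \<partial>lborel)"
        using g by (simp add: emeasure_density D_def)
      also have "\<dots> = 1"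
        using g c by (subst nn_integral_eq_integral) auto
      finally show ?thesis
        by (auto intro!: prob_spaceI simp: real_distribution_def real_distribution_axioms_def)
    qed
    have ch: "char (density lborel (D g)) t = fourier g t / c"
      if g: "integrable lborel g" "\<And>x. 0 \<le> g x" for g t
    proof -
      have [measurable]: "g \<in> borel_measurable borel" using g by auto
      have "char (density lborel (D g)) t = (\<integral>x. (g x / c) *\<^sub>R iexp (t * x) \<partial>lborel)"
        unfolding char_def D_def using g c by (subst integral_density) auto
      also have "\<dots> = (\<integral>x. (cis (t * x) * complex_of_real (g x)) / complex_of_real c \<partial>lborel)"
        by (intro Bochner_Integration.integral_cong) (auto simp: scaleR_conv_of_real cis_conv_exp)
      finally show ?thesis by (simp add: fourier_def)
    qed
    have "density lborel (D p) = density lborel (D q)"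
      by (rule Levy_uniqueness) (auto intro!: rd ext simp: ip iq nn cq c_def[symmetric] ch Fpq)
    then have "AE x in lborel. D p x = D q x"
      by (intro sigma_finite_measure.density_unique[OF lborel.sigma_finite_measure_axioms]) (auto simp: D_def)
    then show ?thesis
      by eventually_elim (use nn c in \<open>auto simp: D_def upq\<close>)
  qed
qed

subsection \<open>Risk of a bounded kernel\<close>

lemma integral_lborel_shift:
  fixes u :: "real \<Rightarrow> 'b::{banach, second_countable_topology}"
  shows "(\<integral>x. u (x - y) \<partial>lborel) = (\<integral>x. u x \<partial>lborel)"
  using lborel_integral_real_affine[of 1 u "- y"] by (simp add: algebra_simps)

lemma integrable_lborel_shift:
  fixes u :: "real \<Rightarrow> 'b::{banach, second_countable_topology}"
  shows "integrable lborel (\<lambda>x. u (x - y)) \<longleftrightarrow> integrable lborel u"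
  using lborel_integrable_real_affine_iff[of 1 u "- y"] by (simp add: algebra_simps)

lemma (in real_distribution) pair_lborel: "pair_sigma_finite M lborel"
  by (simp add: pair_sigma_finite_def sigma_finite_measure_axioms lborel.sigma_finite_measure_axioms)

text \<open>The integral of the dominating function over \<open>x\<close> does not depend on
  \<open>y\<close>, hence is integrable for the probability measure \<open>M\<close>. This supplies
  the hypothesis of Fubini's theorem below.\<close>

lemma (in real_distribution) integrable_pair_shift:
  fixes u :: "real \<Rightarrow> real" and v :: "real \<Rightarrow> real \<Rightarrow> 'b::{banach, second_countable_topology}"
  assumes u: "integrable lborel u"
    and v [measurable]: "(\<lambda>(y, x). v y x) \<in> borel_measurable (borel \<Otimes>\<^sub>M borel)"
    and vu: "\<And>x y. norm (v y x) \<le> C * \<bar>u (x - y)\<bar>"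
  shows "integrable (M \<Otimes>\<^sub>M lborel) (\<lambda>(y, x). v y x)"
proof (rule Bochner_Integration.integrable_bound)
  interpret pair_sigma_finite M lborel by (rule pair_lborel)
  have [measurable]: "u \<in> borel_measurable borel" using u by auto
  show "integrable (M \<Otimes>\<^sub>M lborel) (\<lambda>(y, x). C * \<bar>u (x - y)\<bar>)"
  proof (rule Fubini_integrable)
    have "(\<integral>x. norm (case (y, x) of (y, x) \<Rightarrow> C * \<bar>u (x - y)\<bar>) \<partial>lborel) = (\<integral>x. norm (C * \<bar>u x\<bar>) \<partial>lborel)" for y
      unfolding prod.case by (rule integral_lborel_shift)
    then show "integrable M (\<lambda>y. \<integral>x. norm (case (y, x) of (y, x) \<Rightarrow> C * \<bar>u (x - y)\<bar>) \<partial>lborel)"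
      by simp
    have "integrable lborel (\<lambda>x. C * \<bar>u (x - y)\<bar>)" for y
      using integrable_lborel_shift[of "\<lambda>x. C * \<bar>u x\<bar>" y] u by auto
    then show "AE y in M. integrable lborel (\<lambda>x. case (y, x) of (y, x) \<Rightarrow> C * \<bar>u (x - y)\<bar>)"
      by simp
  qed simp
  show "(\<lambda>(y, x). v y x) \<in> borel_measurable (M \<Otimes>\<^sub>M lborel)"
    by simp
  have "norm (v y x) \<le> norm (C * \<bar>u (x - y)\<bar>)" for x y
    using vu[of y x] by (rule order_trans) simp
  then show "AE p in M \<Otimes>\<^sub>M lborel. norm (case p of (y, x) \<Rightarrow> v y x) \<le> norm (case p of (y, x) \<Rightarrow> C * \<bar>u (x - y)\<bar>)"
    by (intro AE_I2) auto
qed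

text \<open>Later \<open>k\<close> becomes a scaled kernel and \<open>M\<close> the law with density
  \<open>f\<close>. Here \<open>M\<close> is an arbitrary law, and the target of
  \<open>sq_error\<close> is a separate argument.\<close>

locale smoothed_distribution = real_distribution +
  fixes k :: "real \<Rightarrow> real" and B :: real
  assumes k_integrable: "integrable lborel k"
    and k_bounded: "\<bar>k x\<bar> \<le> B"
begin

sublocale pair_sigma_finite M lborel
  by (rule pair_lborel)

definition smoothed :: "real \<Rightarrow> real" where
  "smoothed x = (\<integral>y. k (x - y) \<partial>M)"

definition second_moment :: "real \<Rightarrow> real" where
  "second_moment x = (\<integral>y. (k (x - y))\<^sup>2 \<partial>M)"

definition total_variance :: real where
  "total_variance = (\<integral>x. second_moment x - (smoothed x)\<^sup>2 \<partial>lborel)"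

definition sq_error :: "(real \<Rightarrow> real) \<Rightarrow> real" where
  "sq_error f = (\<integral>x. (smoothed x - f x)\<^sup>2 \<partial>lborel)"

lemma prob_UNIV [simp]: "prob UNIV = 1"
  using prob_space by simp

lemma k_measurable [measurable]: "k \<in> borel_measurable borel"
  using k_integrable by auto

lemma B_nonneg: "0 \<le> B"
  using k_bounded[of 0] by simp

text \<open>Boundedness turns integrability of \<open>k\<close> into integrability of its square, on
  the line and, after shifts, on the product with \<open>M\<close>.\<close>

lemma k_sq_le: "(k x)\<^sup>2 \<le> B * \<bar>k x\<bar>"
  using mult_right_mono[OF k_bounded[of x], of "\<bar>k x\<bar>"] by (simp add: power2_eq_square)

lemma k_sq_integrable: "integrable lborel (\<lambda>x. (k x)\<^sup>2)"
proof (rule Bochner_Integration.integrable_bound)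
  show "integrable lborel (\<lambda>x. B * \<bar>k x\<bar>)" using k_integrable by auto
  show "AE x in lborel. norm ((k x)\<^sup>2) \<le> norm (B * \<bar>k x\<bar>)"
    using k_sq_le B_nonneg by (simp add: abs_mult)
qed simp

lemma integrable_k: "integrable M (\<lambda>y. k (x - y))"
  by (rule integrable_bounded[of _ B]) (use k_bounded in auto)

lemma integrable_k_sq: "integrable M (\<lambda>y. (k (x - y))\<^sup>2)"
  by (rule integrable_bounded[of _ "B\<^sup>2"])
    (use k_bounded in \<open>auto simp: abs_le_square_iff[symmetric] intro: order_trans[OF _ abs_ge_self]\<close>)

lemma smoothed_measurable [measurable]: "smoothed \<in> borel_measurable borel"
  unfolding smoothed_def[abs_def] by measurable

lemma second_moment_measurable [measurable]: "second_moment \<in> borel_measurable borel"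
  unfolding second_moment_def[abs_def] by measurable

lemma second_moment_nonneg: "0 \<le> second_moment x"
  by (simp add: second_moment_def)

lemma variance_eq: "expectation (\<lambda>y. (k (x - y) - smoothed x)\<^sup>2) = second_moment x - (smoothed x)\<^sup>2"
  using integrable_k[of x] integrable_k_sq[of x]
  by (simp add: power2_diff prob_space smoothed_def second_moment_def) (simp add: power2_eq_square)

lemma smoothed_sq_le: "(smoothed x)\<^sup>2 \<le> second_moment x"
proof -
  have "0 \<le> expectation (\<lambda>y. (k (x - y) - smoothed x)\<^sup>2)" by simp
  then show ?thesis by (simp add: variance_eq)
qed

lemma integrable_pair_k:
  "integrable (M \<Otimes>\<^sub>M lborel) (\<lambda>(y, x). k (x - y))"
  by (rule integrable_pair_shift[OF k_integrable, of _ 1]) auto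

lemma integrable_pair_k_sq:
  "integrable (M \<Otimes>\<^sub>M lborel) (\<lambda>(y, x). (k (x - y))\<^sup>2)"
  by (rule integrable_pair_shift[OF k_integrable, of _ B]) (use k_sq_le in auto)

lemma smoothed_integrable: "integrable lborel smoothed"
  unfolding smoothed_def[abs_def] by (rule integrable_snd[OF integrable_pair_k])

lemma second_moment_integrable: "integrable lborel second_moment"
  unfolding second_moment_def[abs_def] by (rule integrable_snd[OF integrable_pair_k_sq])

lemma integral_second_moment: "(\<integral>x. second_moment x \<partial>lborel) = (\<integral>x. (k x)\<^sup>2 \<partial>lborel)"
  unfolding second_moment_def[abs_def] using integrable_pair_k_sq
  by (subst Fubini_integral)
    (simp_all add: integral_lborel_shift[of "\<lambda>x. (k x)\<^sup>2"] prob_space)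

lemma smoothed_sq_integrable: "integrable lborel (\<lambda>x. (smoothed x)\<^sup>2)"
  by (rule Bochner_Integration.integrable_bound[OF second_moment_integrable])
    (use smoothed_sq_le second_moment_nonneg in auto)

lemma total_variance_eq:
  "total_variance = (\<integral>x. (k x)\<^sup>2 \<partial>lborel) - (\<integral>x. (smoothed x)\<^sup>2 \<partial>lborel)"
  unfolding total_variance_def using second_moment_integrable smoothed_sq_integrable
  by (simp add: integral_second_moment)

lemma total_variance_nonneg: "0 \<le> total_variance"
  unfolding total_variance_def using smoothed_sq_le by simp

lemma sq_error_nonneg: "0 \<le> sq_error f"
  by (simp add: sq_error_def)

lemma sq_error_integrable:
  assumes [measurable]: "f \<in> borel_measurable borel" and f: "integrable lborel (\<lambda>x. (f x)\<^sup>2)"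
  shows "integrable lborel (\<lambda>x. (smoothed x - f x)\<^sup>2)"
proof -
  have "integrable lborel (\<lambda>x. smoothed x * f x)"
    using f smoothed_sq_integrable by (intro integrable_mult_of_squares) auto
  then show ?thesis
    using f smoothed_sq_integrable by (simp add: power2_diff mult.assoc)
qed

text \<open>Tonelli's theorem moves the integral over \<open>x\<close> outside; for each
  \<open>x\<close> what remains is the decomposition for the sample mean of
  \<open>\<lambda>y. k (x - y)\<close>.\<close>

lemma mise_eq:
  assumes [measurable]: "f \<in> borel_measurable borel" and f: "integrable lborel (\<lambda>x. (f x)\<^sup>2)" and n: "0 < n"
  shows "(\<integral>\<^sup>+ X. (\<integral>\<^sup>+ x. ennreal (((\<Sum>i<n. k (x - X i)) / real n - f x)\<^sup>2) \<partial>lborel) \<partial>PiM {..<n} (\<lambda>_. M))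
    = ennreal (total_variance / real n + sq_error f)"
proof -
  let ?P = "PiM {..<n} (\<lambda>_. M)"
  interpret P: product_prob_space "\<lambda>_. M" "{..<n}"
    by (intro product_prob_spaceI) (rule prob_space_axioms)
  interpret PL: pair_sigma_finite ?P lborel
    by (simp add: pair_sigma_finite_def P.P.sigma_finite_measure_axioms lborel.sigma_finite_measure_axioms)
  have [measurable]: "(\<lambda>p. k (snd p - fst p i)) \<in> borel_measurable (?P \<Otimes>\<^sub>M lborel)" if "i < n" for i
  proof -
    have [measurable]: "(\<lambda>p. fst p i) \<in> borel_measurable (?P \<Otimes>\<^sub>M lborel)"
      using measurable_compose[OF measurable_fst measurable_component_singleton[of i "{..<n}" "\<lambda>_. M"]] that
      by (simp add: measurable_cong_sets[OF refl events_eq_borel])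
    show ?thesis by simp
  qed
  have "(\<lambda>p. ennreal (((\<Sum>i<n. k (snd p - fst p i)) / real n - f (snd p))\<^sup>2)) \<in> borel_measurable (?P \<Otimes>\<^sub>M lborel)"
    by measurable
  then have "(\<lambda>(X, x). ennreal (((\<Sum>i<n. k (x - X i)) / real n - f x)\<^sup>2)) \<in> borel_measurable (?P \<Otimes>\<^sub>M lborel)"
    by (simp add: case_prod_beta')
  then have "(\<integral>\<^sup>+ X. (\<integral>\<^sup>+ x. ennreal (((\<Sum>i<n. k (x - X i)) / real n - f x)\<^sup>2) \<partial>lborel) \<partial>?P)
    = (\<integral>\<^sup>+ x. (\<integral>\<^sup>+ X. ennreal (((\<Sum>i<n. k (x - X i)) / real n - f x)\<^sup>2) \<partial>?P) \<partial>lborel)"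
    by (rule PL.Fubini'[symmetric])
  also have "\<dots> = (\<integral>\<^sup>+ x. ennreal ((second_moment x - (smoothed x)\<^sup>2) / real n + (smoothed x - f x)\<^sup>2) \<partial>lborel)"
    using n k_bounded
    by (subst nn_integral_PiM_sample_mean[where B = B]) (auto simp: second_moment_def smoothed_def)
  also have "\<dots> = ennreal (\<integral>x. (second_moment x - (smoothed x)\<^sup>2) / real n + (smoothed x - f x)\<^sup>2 \<partial>lborel)"
    using second_moment_integrable smoothed_sq_integrable sq_error_integrable[OF assms(1,2)] smoothed_sq_le
    by (intro nn_integral_eq_integral) auto
  also have "\<dots> = ennreal (total_variance / real n + sq_error f)"
    using second_moment_integrable smoothed_sq_integrable sq_error_integrable[OF assms(1,2)]
    by (simp add: total_variance_def sq_error_def)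
  finally show ?thesis .
qed

text \<open>Convolution becomes multiplication: after Fubini, \<open>cis (t * x)\<close> splits into
  \<open>cis (t * (x - y))\<close> and a factor depending on \<open>y\<close> alone.\<close>

lemma fourier_smoothed: "fourier smoothed t = fourier k t * char M t"
proof -
  have [measurable]: "(\<lambda>p. cis (t * snd p) * complex_of_real (k (snd p - fst p))) \<in> borel_measurable (borel \<Otimes>\<^sub>M borel)"
    by measurable
  have int: "integrable (M \<Otimes>\<^sub>M lborel) (\<lambda>(y, x). cis (t * x) * complex_of_real (k (x - y)))"
    by (rule integrable_pair_shift[OF k_integrable, of _ 1]) (auto simp: norm_mult case_prod_beta')
  have "fourier smoothed t = (\<integral>x. (\<integral>y. cis (t * x) * complex_of_real (k (x - y)) \<partial>M) \<partial>lborel)"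
    unfolding fourier_def smoothed_def by simp
  also have "\<dots> = (\<integral>y. (\<integral>x. cis (t * x) * complex_of_real (k (x - y)) \<partial>lborel) \<partial>M)"
    by (rule Fubini_integral[OF int])
  also have "\<dots> = (\<integral>y. fourier k t * iexp (t * y) \<partial>M)"
  proof (rule Bochner_Integration.integral_cong[OF refl])
    fix y
    have "cis (t * x) = cis (t * (x - y)) * iexp (t * y)" for x
      unfolding cis_conv_exp[symmetric] cis_mult by (simp add: algebra_simps)
    then have "(\<integral>x. cis (t * x) * complex_of_real (k (x - y)) \<partial>lborel)
        = (\<integral>x. (cis (t * (x - y)) * complex_of_real (k (x - y))) * iexp (t * y) \<partial>lborel)"
      by (simp add: mult_ac)
    also have "\<dots> = fourier k t * iexp (t * y)"
      using integral_lborel_shift[of "\<lambda>x. cis (t * x) * complex_of_real (k x)" y]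
      by (simp add: fourier_def)
    finally show "(\<integral>x. cis (t * x) * complex_of_real (k (x - y)) \<partial>lborel) = fourier k t * iexp (t * y)" .
  qed
  also have "\<dots> = fourier k t * char M t"
    by (simp add: char_def)
  finally show ?thesis .
qed

section \<open>Pairing with a test function\<close>

definition paired :: "(real \<Rightarrow> real) \<Rightarrow> real \<Rightarrow> real" where
  "paired g y = (\<integral>x. k (x - y) * g x \<partial>lborel)"

context
  fixes g :: "real \<Rightarrow> real"
  assumes g_measurable [measurable]: "g \<in> borel_measurable borel"
    and g_bounded: "\<And>x. \<bar>g x\<bar> \<le> 1"
    and g_sq_integrable: "integrable lborel (\<lambda>x. (g x)\<^sup>2)"
begin

lemma integrable_pair_k_mult: "integrable (M \<Otimes>\<^sub>M lborel) (\<lambda>(y, x). k (x - y) * g x)"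
  by (rule integrable_pair_shift[OF k_integrable, of _ 1])
    (use g_bounded in \<open>auto simp: abs_mult mult_left_le\<close>)

text \<open>Fubini's theorem turns inner products with \<open>smoothed\<close> into moments of
  \<open>paired g\<close>, the form in which test functions take the place of Plancherel's
  theorem.\<close>

lemma integral_smoothed_mult: "(\<integral>x. smoothed x * g x \<partial>lborel) = expectation (paired g)"
proof -
  have "(\<integral>x. smoothed x * g x \<partial>lborel) = (\<integral>x. (\<integral>y. k (x - y) * g x \<partial>M) \<partial>lborel)"
    by (simp add: smoothed_def)
  also have "\<dots> = (\<integral>y. (\<integral>x. k (x - y) * g x \<partial>lborel) \<partial>M)"
    by (rule Fubini_integral[OF integrable_pair_k_mult])
  finally show ?thesis by (simp add: paired_def[abs_def])
qed

lemma paired_sq_error_le: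
  assumes [measurable]: "f \<in> borel_measurable borel" and f: "integrable lborel (\<lambda>x. (f x)\<^sup>2)"
  shows "(expectation (paired g) - (\<integral>x. f x * g x \<partial>lborel))\<^sup>2 \<le> sq_error f * (\<integral>x. (g x)\<^sup>2 \<partial>lborel)"
proof -
  have "integrable lborel (\<lambda>x. f x * g x)" "integrable lborel (\<lambda>x. smoothed x * g x)"
    using f smoothed_sq_integrable g_sq_integrable by (auto intro!: integrable_mult_of_squares)
  then have "expectation (paired g) - (\<integral>x. f x * g x \<partial>lborel) = (\<integral>x. (smoothed x - f x) * g x \<partial>lborel)"
    by (simp add: integral_smoothed_mult[symmetric] left_diff_distrib)
  then show ?thesis
    using square_integral_mult_le[of "\<lambda>x. smoothed x - f x" lborel g] sq_error_integrable[OF assms] g_sq_integrable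
    by (simp add: sq_error_def)
qed

text \<open>For fixed \<open>y\<close> the deviation of \<open>paired g y\<close> from its mean is
  the inner product of \<open>k (x - y) - smoothed x\<close> with \<open>g\<close>. Cauchy-Schwarz
  in \<open>x\<close>, integration over \<open>y\<close> and Fubini produce the total
  variance.\<close>

lemma paired_variance_le:
  "expectation (\<lambda>y. (paired g y - expectation (paired g))\<^sup>2) \<le> total_variance * (\<integral>x. (g x)\<^sup>2 \<partial>lborel)"
proof -
  let ?G = "\<integral>x. (g x)\<^sup>2 \<partial>lborel"
  let ?v = "\<lambda>y x. (k (x - y) - smoothed x)\<^sup>2"
  have kg: "integrable lborel (\<lambda>x. k (x - y) * g x)" for y
  proof (rule integrable_mult_of_squares)
    show "integrable lborel (\<lambda>x. (k (x - y))\<^sup>2)"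
      using k_sq_integrable integrable_lborel_shift[of "\<lambda>x. (k x)\<^sup>2"] by simp
  qed (use g_sq_integrable in auto)
  have kv: "integrable lborel (?v y)" for y
  proof -
    have "integrable lborel (\<lambda>x. (k (x - y))\<^sup>2)"
      using k_sq_integrable integrable_lborel_shift[of "\<lambda>x. (k x)\<^sup>2"] by simp
    moreover have "integrable lborel (\<lambda>x. k (x - y) * smoothed x)"
      using calculation smoothed_sq_integrable by (intro integrable_mult_of_squares) auto
    ultimately show ?thesis
      using smoothed_sq_integrable by (simp add: power2_diff mult.assoc)
  qed
  have pv: "integrable (M \<Otimes>\<^sub>M lborel) (\<lambda>(y, x). ?v y x)"
  proof -
    have *: "integrable (M \<Otimes>\<^sub>M lborel) (\<lambda>(y, x). k (x - y) * smoothed x)"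
    proof (rule integrable_pair_shift[OF k_integrable, of _ B])
      have "\<bar>smoothed x\<bar> \<le> B" for x
        unfolding smoothed_def using k_bounded
        by (intro order_trans[OF integral_abs_bound] integral_le_const) (auto simp: integrable_k)
      then show "norm (k (x - y) * smoothed x) \<le> B * \<bar>k (x - y)\<bar>" for x y
        by (simp add: abs_mult mult.commute mult_right_mono)
    qed simp
    \<comment> \<open>This term is constant in \<open>y\<close> and integrable on the product
      because \<open>M\<close> has mass 1.\<close>
    have "integrable (M \<Otimes>\<^sub>M lborel) (\<lambda>(y, x). (smoothed x)\<^sup>2)"
      by (intro Fubini_integrable) (use smoothed_sq_integrable in auto)
    then have "integrable (M \<Otimes>\<^sub>M lborel) (\<lambda>p. (case p of (y, x) \<Rightarrow> (k (x - y))\<^sup>2)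
        + (case p of (y, x) \<Rightarrow> (smoothed x)\<^sup>2) - 2 * (case p of (y, x) \<Rightarrow> k (x - y) * smoothed x))"
      using * integrable_pair_k_sq by auto
    then show ?thesis
      by (rule Bochner_Integration.integrable_cong[THEN iffD1, rotated 2]) (auto simp: power2_diff)
  qed
  have "(paired g y - expectation (paired g))\<^sup>2 \<le> (\<integral>x. ?v y x \<partial>lborel) * ?G" for y
  proof -
    have "integrable lborel (\<lambda>x. smoothed x * g x)"
      using smoothed_sq_integrable g_sq_integrable by (intro integrable_mult_of_squares) auto
    then have "paired g y - expectation (paired g) = (\<integral>x. (k (x - y) - smoothed x) * g x \<partial>lborel)"
      using kg by (simp add: integral_smoothed_mult[symmetric] paired_def left_diff_distrib)
    then show ?thesis
      using square_integral_mult_le[of "\<lambda>x. k (x - y) - smoothed x" lborel g] kv g_sq_integrable by simp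
  qed
  then have "expectation (\<lambda>y. (paired g y - expectation (paired g))\<^sup>2) \<le> expectation (\<lambda>y. (\<integral>x. ?v y x \<partial>lborel) * ?G)"
    using integrable_fst[OF pv] by (intro integral_mono') auto
  also have "\<dots> = (\<integral>x. expectation (\<lambda>y. ?v y x) \<partial>lborel) * ?G"
    using Fubini_integral[OF pv] by simp
  also have "\<dots> = total_variance * ?G"
    by (simp add: variance_eq total_variance_def)
  finally show ?thesis .
qed

end

end

subsection \<open>Dependence on the bandwidth\<close>

lemma fourier_uminus: "fourier g (- t) = cnj (fourier g t)"
proof -
  have "cnj (fourier g t) = (\<integral>x. cnj (cis (t * x) * complex_of_real (g x)) \<partial>lborel)"
    unfolding fourier_def by (rule Bochner_Integration.integral_cnj[symmetric])
  then show ?thesis by (simp add: fourier_def cis_cnj)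
qed

lemma isCont_fourier:
  assumes g: "integrable lborel g"
  shows "isCont (fourier g) t"
  unfolding continuous_at_sequentially
proof (intro allI impI)
  fix s :: "nat \<Rightarrow> real"
  assume s: "s \<longlonglongrightarrow> t"
  have [measurable]: "g \<in> borel_measurable borel" using g by auto
  have "(\<lambda>n. \<integral>x. cis (s n * x) * complex_of_real (g x) \<partial>lborel)
      \<longlonglongrightarrow> (\<integral>x. cis (t * x) * complex_of_real (g x) \<partial>lborel)"
  proof (rule integral_dominated_convergence)
    show "integrable lborel (\<lambda>x. \<bar>g x\<bar>)" using g by auto
    show "AE x in lborel. (\<lambda>n. cis (s n * x) * complex_of_real (g x)) \<longlonglongrightarrow> cis (t * x) * complex_of_real (g x)"
      using s by (intro AE_I2 tendsto_intros)
  qed (auto simp: norm_mult)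
  then show "(fourier g \<circ> s) \<longlonglongrightarrow> fourier g t"
    by (simp add: fourier_def o_def)
qed

text \<open>Two solutions differ by a multiple of \<open>2 * pi / t\<close>. Since countable sets
  are Lebesgue null, \<open>cis (t * y)\<close> cannot be almost surely constant under a law with a
  density.\<close>

lemma countable_cis_level_set:
  assumes "t \<noteq> 0"
  shows "countable {y. cis (t * y) = w}"
proof (cases "\<exists>y0. cis (t * y0) = w")
  case True
  then obtain y0 where y0: "cis (t * y0) = w" by blast
  have "{y. cis (t * y) = w} \<subseteq> (\<lambda>n::int. y0 + 2 * pi * real_of_int n / t) ` UNIV"
  proof
    fix y assume "y \<in> {y. cis (t * y) = w}"
    then have "cis (t * y - t * y0) = 1"
      using y0 cis_neq_zero[of "t * y0"] by (simp add: cis_divide[symmetric])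
    then have "cos (t * y - t * y0) = 1"
      by (simp add: complex_eq_iff)
    then obtain n :: int where "t * y - t * y0 = real_of_int n * 2 * pi"
      using cos_one_2pi_int by blast
    then have "y = y0 + 2 * pi * real_of_int n / t"
      using assms by (simp add: field_simps)
    then show "y \<in> (\<lambda>n::int. y0 + 2 * pi * real_of_int n / t) ` UNIV" by blast
  qed
  then show ?thesis by (rule countable_subset) auto
qed auto

locale kernel_density_estimation =
  fixes K f :: "real \<Rightarrow> real"
  assumes kernel: "is_kernel K"
    and density: "is_density f"
    and f_sq_integrable: "integrable lborel (\<lambda>x. (f x)\<^sup>2)"
begin

abbreviation \<mu> :: "real measure" where
  "\<mu> \<equiv> density lborel (\<lambda>x. ennreal (f x))"

abbreviation variance_at :: "real \<Rightarrow> real" where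
  "variance_at h \<equiv> smoothed_distribution.total_variance \<mu> (scaled_kernel K h)"

abbreviation bias_at :: "real \<Rightarrow> real" where
  "bias_at h \<equiv> smoothed_distribution.sq_error \<mu> (scaled_kernel K h) f"

abbreviation mean_at :: "real \<Rightarrow> real \<Rightarrow> real" where
  "mean_at h \<equiv> smoothed_distribution.smoothed \<mu> (scaled_kernel K h)"

abbreviation roughness :: "(real \<Rightarrow> real) \<Rightarrow> real" where
  "roughness g \<equiv> (\<integral>x. (g x)\<^sup>2 \<partial>lborel)"

lemma K_integrable: "integrable lborel K" and K_integral: "integral\<^sup>L lborel K = 1"
  using kernel by (auto simp: is_kernel_def)

lemma K_measurable [measurable]: "K \<in> borel_measurable borel"
  using K_integrable by auto

lemma f_measurable [measurable]: "f \<in> borel_measurable borel" and f_nonneg: "0 \<le> f x"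
  and f_integrable: "integrable lborel f" and f_integral: "integral\<^sup>L lborel f = 1"
  using density by (auto simp: is_density_def)

lemma real_distribution_\<mu>: "real_distribution \<mu>"
proof -
  have "emeasure \<mu> (space \<mu>) = (\<integral>\<^sup>+x. ennreal (f x) \<partial>lborel)"
    by (simp add: emeasure_density)
  also have "\<dots> = 1"
    using f_nonneg f_integral by (subst nn_integral_eq_integral[OF f_integrable]) auto
  finally show ?thesis
    by (auto intro!: prob_spaceI simp: real_distribution_def real_distribution_axioms_def)
qed

sublocale real_distribution \<mu>
  by (rule real_distribution_\<mu>)

lemma expectation_eq: "g \<in> borel_measurable borel \<Longrightarrow> expectation g = (\<integral>x. f x * g x \<partial>lborel)" for g :: "real \<Rightarrow> real"
  using f_nonneg by (subst integral_density) auto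

lemma integral_lborel_scale: "(\<integral>x. G (x / h) \<partial>lborel) = h * (\<integral>x. G x \<partial>lborel)"
  if "h > 0" for G :: "real \<Rightarrow> real" and h
  using lborel_integral_real_affine[of h "\<lambda>x. G (x / h)" 0] that by simp

text \<open>The bound varies with the bandwidth and is therefore obtained. The constants of the
  locale do not take it as an argument, so their properties can be stated without it.\<close>

lemma smoothed_distribution_at:
  assumes h: "h > 0"
  obtains B where "smoothed_distribution \<mu> (scaled_kernel K h) B"
proof -
  obtain B where B: "\<And>x. \<bar>K x\<bar> \<le> B"
    using kernel by (auto simp: is_kernel_def)
  have "integrable lborel (\<lambda>x. K (0 + (1 / h) * x))"
    using h by (intro lborel_integrable_real_affine[OF K_integrable]) simp
  then have "integrable lborel (scaled_kernel K h)"
    by (simp add: scaled_kernel_def[abs_def])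
  moreover have "\<bar>scaled_kernel K h x\<bar> \<le> B / h" for x
    using B h by (simp add: scaled_kernel_def abs_divide divide_right_mono)
  ultimately have "smoothed_distribution \<mu> (scaled_kernel K h) (B / h)"
    by unfold_locales
  then show thesis by (rule that)
qed

lemma roughness_scaled_kernel:
  assumes "h > 0" shows "roughness (scaled_kernel K h) = roughness K / h"
proof -
  have "roughness (scaled_kernel K h) = (\<integral>x. (K (x / h))\<^sup>2 / h\<^sup>2 \<partial>lborel)"
    by (simp add: scaled_kernel_def power_divide)
  also have "\<dots> = roughness K / h"
    using integral_lborel_scale[OF assms, of "\<lambda>x. (K x)\<^sup>2"] assms by (simp add: power2_eq_square)
  finally show ?thesis .
qed

lemma fourier_scaled_kernel:
  assumes "h > 0" shows "fourier (scaled_kernel K h) t = fourier K (h * t)"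
proof -
  have "fourier (scaled_kernel K h) t = h *\<^sub>R (\<integral>x. cis (t * (h * x)) * complex_of_real (K x / h) \<partial>lborel)"
    unfolding fourier_def using assms
    by (subst lborel_integral_real_affine[of h _ 0]) (simp_all add: scaled_kernel_def)
  also have "\<dots> = fourier K (h * t)"
    unfolding fourier_def using assms
    by (simp add: scaleR_conv_of_real mult_ac)
  finally show ?thesis .
qed

lemma char_\<mu>: "char \<mu> t = fourier f t"
proof -
  have "char \<mu> t = (\<integral>x. f x *\<^sub>R iexp (t * x) \<partial>lborel)"
    unfolding char_def using f_nonneg by (subst integral_density) auto
  then show ?thesis
    by (simp add: fourier_def cis_conv_exp scaleR_conv_of_real mult_ac)
qed

lemma fourier_mean_at: "h > 0 \<Longrightarrow> fourier (mean_at h) t = fourier K (h * t) * fourier f t"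
  by (rule smoothed_distribution_at, assumption)
    (simp add: smoothed_distribution.fourier_smoothed fourier_scaled_kernel char_\<mu>)

lemma roughness_pos:
  assumes "integrable lborel g" "integrable lborel (\<lambda>x. (g x)\<^sup>2)" "integral\<^sup>L lborel g = 1"
  shows "roughness g > 0"
proof (rule ccontr)
  assume "\<not> roughness g > 0"
  moreover have "roughness g \<ge> 0" by simp
  ultimately have "roughness g = 0" by linarith
  then have "AE x in lborel. (g x)\<^sup>2 = 0"
    using integral_nonneg_eq_0_iff_AE[OF assms(2)] by simp
  then have "integral\<^sup>L lborel g = 0"
    by (intro integral_eq_zero_AE) simp
  then show False using assms(3) by simp
qed

lemma roughness_K_pos: "roughness K > 0"
  using kernel by (intro roughness_pos) (auto simp: is_kernel_def)

lemma roughness_f_pos: "roughness f > 0"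
  using f_integrable f_sq_integrable f_integral by (intro roughness_pos)

lemma MISE_eq:
  assumes "h > 0" "0 < n"
  shows "MISE n f K h = ennreal (variance_at h / real n + bias_at h)"
proof -
  obtain B where "smoothed_distribution \<mu> (scaled_kernel K h) B"
    using smoothed_distribution_at assms(1) .
  then show ?thesis
    using smoothed_distribution.mise_eq[of \<mu> "scaled_kernel K h" B f n] f_sq_integrable assms(2)
    by (simp add: MISE_def kde_def sample_law_def)
qed

lemma variance_at_nonneg: "h > 0 \<Longrightarrow> 0 \<le> variance_at h"
  by (erule smoothed_distribution_at) (simp add: smoothed_distribution.total_variance_nonneg)

lemma bias_at_nonneg: "h > 0 \<Longrightarrow> 0 \<le> bias_at h"
  by (erule smoothed_distribution_at) (simp add: smoothed_distribution.sq_error_nonneg)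

lemma variance_at_eq: "h > 0 \<Longrightarrow> variance_at h = roughness K / h - roughness (mean_at h)"
  by (rule smoothed_distribution_at, assumption)
    (simp add: smoothed_distribution.total_variance_eq roughness_scaled_kernel)

text \<open>Nonnegativity of the variance gives this bound, which makes the mean small in square
  norm for large bandwidths.\<close>

lemma roughness_mean_at_le: "h > 0 \<Longrightarrow> roughness (mean_at h) \<le> roughness K / h"
  using variance_at_eq[of h] variance_at_nonneg[of h] by simp

text \<open>When the bias is small, the first inequality excludes large bandwidths and the second,
  for bounded variance, small ones.\<close>

lemma
  assumes "h > 0"
  shows roughness_f_le: "roughness f \<le> 2 * bias_at h + 2 * roughness (mean_at h)"
    and roughness_mean_le: "roughness (mean_at h) \<le> 2 * bias_at h + 2 * roughness f"
proof -
  obtain B where "smoothed_distribution \<mu> (scaled_kernel K h) B"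
    using smoothed_distribution_at assms .
  then interpret S: smoothed_distribution \<mu> "scaled_kernel K h" B .
  show "roughness f \<le> 2 * bias_at h + 2 * roughness (mean_at h)"
    using square_sum_integral_le[of f lborel "mean_at h"] f_sq_integrable S.smoothed_sq_integrable
    by (simp add: S.sq_error_def power2_commute)
  show "roughness (mean_at h) \<le> 2 * bias_at h + 2 * roughness f"
    using square_sum_integral_le[of "mean_at h" lborel f] f_sq_integrable S.smoothed_sq_integrable
    by (simp add: S.sq_error_def)
qed

text \<open>Conjugation extends the identity to negative arguments. The difference of the mean and
  \<open>f\<close> is then integrable with vanishing transform, hence 0 almost everywhere.\<close>

lemma bias_at_eq_0:
  assumes h: "h > 0" and F: "\<And>t. 0 \<le> t \<Longrightarrow> fourier K (h * t) * fourier f t = fourier f t"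
  shows "bias_at h = 0"
proof -
  obtain B where "smoothed_distribution \<mu> (scaled_kernel K h) B"
    using smoothed_distribution_at h .
  then interpret S: smoothed_distribution \<mu> "scaled_kernel K h" B .
  have *: "fourier K (h * t) * fourier f t = fourier f t" for t
  proof (cases "0 \<le> t")
    case False
    then have "cnj (fourier K (h * - t) * fourier f (- t)) = cnj (fourier f (- t))"
      using F[of "- t"] by simp
    then show ?thesis
      by (simp add: fourier_uminus)
  qed (rule F)
  have "AE x in lborel. mean_at h x - f x = 0"
  proof (rule AE_eq_0_of_fourier_eq_0)
    show "integrable lborel (\<lambda>x. mean_at h x - f x)"
      using S.smoothed_integrable f_integrable by simp
    fix t
    have "fourier (\<lambda>x. mean_at h x - f x) t = fourier (mean_at h) t - fourier f t"
      unfolding fourier_def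
      by (subst Bochner_Integration.integral_diff[symmetric])
        (simp_all add: integrable_fourier S.smoothed_integrable f_integrable right_diff_distrib)
    then show "fourier (\<lambda>x. mean_at h x - f x) t = 0"
      using * by (simp add: fourier_mean_at[OF h])
  qed
  then have "(\<integral>x. (mean_at h x - f x)\<^sup>2 \<partial>lborel) = 0"
    by (intro integral_eq_zero_AE) simp
  then show ?thesis by (simp add: S.sq_error_def)
qed

text \<open>Were the Fourier transform of \<open>K\<close> identically 1, the mean would equal \<open>f\<close> for every
  bandwidth, although its \<open>L\<^sup>2\<close> norm tends to 0 as the bandwidth grows.\<close>

lemma fourier_K_neq_1: "\<exists>t\<ge>0. fourier K t \<noteq> 1"
proof (rule ccontr)
  assume "\<not> (\<exists>t\<ge>0. fourier K t \<noteq> 1)"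
  then have 1: "\<And>t. 0 \<le> t \<Longrightarrow> fourier K t = 1" by auto
  \<comment> \<open>Chosen so that \<open>2 * (roughness K / h)\<close> is half of
    \<open>roughness f\<close>.\<close>
  define h where "h = 4 * roughness K / roughness f"
  have h: "h > 0" using roughness_K_pos roughness_f_pos by (simp add: h_def)
  have "bias_at h = 0"
    using h by (intro bias_at_eq_0) (auto simp: 1)
  then have "roughness f \<le> 2 * (roughness K / h)"
    using roughness_f_le[OF h] roughness_mean_at_le[OF h] by simp
  also have "\<dots> = roughness f / 2"
    using roughness_K_pos roughness_f_pos by (simp add: h_def)
  finally show False using roughness_f_pos by simp
qed

lemma convergent_bandwidths:
  assumes pos: "\<And>k. 0 < H k" and bias: "(\<lambda>k. bias_at (H k)) \<longlonglongrightarrow> 0" and var: "\<And>k. variance_at (H k) \<le> C"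
  obtains h r where "0 < h" "strict_mono (r :: nat \<Rightarrow> nat)" "(\<lambda>k. H (r k)) \<longlonglongrightarrow> h"
proof -
  \<comment> \<open>For \<open>a\<close>: \<open>roughness K / h\<close> is the variance plus the
    squared norm of the mean, at most \<open>C + 2 * bias_at h + 2 * roughness f\<close>, and the
    bias is eventually below \<open>roughness f / 4\<close>. For \<open>b\<close>: such a bias
    leaves \<open>roughness f / 2\<close> as a lower bound of
    \<open>2 * roughness K / h\<close>.\<close>
  define a b where "a = roughness K / (C + 3 * roughness f)" and "b = 4 * roughness K / roughness f"
  have F: "roughness f > 0" and R: "roughness K > 0"
    by (rule roughness_f_pos roughness_K_pos)+
  have C: "0 \<le> C" using var[of 0] variance_at_nonneg[OF pos[of 0]] by simp
  have "a > 0" using F R C by (simp add: a_def)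
  obtain N where N: "\<And>k. k \<ge> N \<Longrightarrow> bias_at (H k) < roughness f / 4"
    using order_tendstoD(2)[OF bias, of "roughness f / 4"] F by (auto simp: eventually_sequentially)
  have "H (k + N) \<in> {a..b}" for k
  proof -
    define h where "h = H (k + N)"
    have h: "h > 0" and e: "bias_at h < roughness f / 4" and v: "variance_at h \<le> C"
      using pos N var by (auto simp: h_def)
    have "roughness K / h \<le> C + 3 * roughness f"
      using variance_at_eq[OF h] roughness_mean_le[OF h] v e F by linarith
    then have "a \<le> h" using h F C by (simp add: a_def field_simps)
    moreover have "roughness f / 4 \<le> roughness K / h"
      using roughness_f_le[OF h] roughness_mean_at_le[OF h] e F by linarith
    then have "h \<le> b" using h F by (simp add: b_def field_simps)
    ultimately show ?thesis by (simp add: h_def)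
  qed
  then obtain h r where hr: "h \<in> {a..b}" "strict_mono r" "((\<lambda>k. H (k + N)) \<circ> r) \<longlonglongrightarrow> h"
    using compact_imp_seq_compact[OF compact_Icc, of a b] unfolding seq_compact_def by metis
  show thesis
  proof (rule that)
    show "0 < h" using hr(1) \<open>a > 0\<close> by simp
    \<comment> \<open>Compactness was applied to the tail from \<open>N\<close> on, so the extracted
      indices are shifted by \<open>N\<close>.\<close>
    show "strict_mono (\<lambda>k. r k + N)" using hr(2) by (simp add: strict_mono_def)
    show "(\<lambda>k. H (r k + N)) \<longlonglongrightarrow> h" using hr(3) by (simp add: o_def)
  qed
qed

section \<open>Kernel averages of test functions and their limits\<close>

definition kernel_mean :: "(real \<Rightarrow> real) \<Rightarrow> real \<Rightarrow> real \<Rightarrow> real" where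
  "kernel_mean g h y = (\<integral>u. K u * g (y + h * u) \<partial>lborel)"

text \<open>Substitute \<open>x = y + h * u\<close>. The bandwidth moves from the kernel into the
  argument of the test function, where continuity of \<open>g\<close> controls it.\<close>

lemma paired_scaled_kernel:
  assumes h: "h > 0"
  shows "smoothed_distribution.paired (scaled_kernel K h) g = kernel_mean g h"
proof
  fix y
  obtain B where "smoothed_distribution \<mu> (scaled_kernel K h) B"
    using smoothed_distribution_at h .
  then interpret S: smoothed_distribution \<mu> "scaled_kernel K h" B .
  have "S.paired g y = \<bar>h\<bar> *\<^sub>R (\<integral>u. scaled_kernel K h (y + h * u - y) * g (y + h * u) \<partial>lborel)"
    unfolding S.paired_def using h by (intro lborel_integral_real_affine) simp
  also have "\<dots> = (\<integral>u. K u * g (y + h * u) \<partial>lborel)"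
    using h by (simp add: scaled_kernel_def)
  finally show "S.paired g y = kernel_mean g h y" by (simp add: kernel_mean_def)
qed

lemma kernel_mean_measurable [measurable]:
  assumes [measurable]: "g \<in> borel_measurable borel"
  shows "kernel_mean g h \<in> borel_measurable borel"
  unfolding kernel_mean_def[abs_def] by measurable

lemma kernel_mean_integrable:
  assumes [measurable]: "g \<in> borel_measurable borel" and "\<And>x. \<bar>g x\<bar> \<le> 1"
  shows "integrable lborel (\<lambda>u. K u * g (y + h * u))"
  by (rule Bochner_Integration.integrable_bound[OF K_integrable])
    (use assms in \<open>auto simp: abs_mult mult_left_le\<close>)

text \<open>The bound is uniform in \<open>y\<close> and \<open>h\<close>, so it serves as
  dominating constant for limits of moments of kernel means.\<close>

lemma kernel_mean_bounded:
  assumes [measurable]: "g \<in> borel_measurable borel" and g: "\<And>x. \<bar>g x\<bar> \<le> 1"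
  shows "\<bar>kernel_mean g h y\<bar> \<le> (\<integral>u. \<bar>K u\<bar> \<partial>lborel)"
proof -
  have "\<bar>kernel_mean g h y\<bar> \<le> (\<integral>u. \<bar>K u * g (y + h * u)\<bar> \<partial>lborel)"
    unfolding kernel_mean_def by (rule integral_abs_bound)
  also have "\<dots> \<le> (\<integral>u. \<bar>K u\<bar> \<partial>lborel)"
    using K_integrable kernel_mean_integrable[OF assms] g
    by (intro integral_mono integrable_abs) (auto simp: abs_mult mult_left_le)
  finally show ?thesis .
qed

text \<open>Dominated convergence with bound \<open>\<bar>K u\<bar>\<close>. Function and bandwidth
  both vary, which covers a bandwidth limit for fixed \<open>g\<close> as well as the removal of a
  cutoff at fixed \<open>h\<close>.\<close>

lemma kernel_mean_tendsto:
  assumes [measurable]: "\<And>n. g n \<in> borel_measurable borel" "g' \<in> borel_measurable borel"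
    and g: "\<And>n x. \<bar>g n x\<bar> \<le> 1"
    and lim: "\<And>u. (\<lambda>n. g n (y + H n * u)) \<longlonglongrightarrow> g' (y + h * u)"
  shows "(\<lambda>n. kernel_mean (g n) (H n) y) \<longlonglongrightarrow> kernel_mean g' h y"
  unfolding kernel_mean_def
proof (rule integral_dominated_convergence)
  show "integrable lborel (\<lambda>u. \<bar>K u\<bar>)" using K_integrable by auto
  show "AE u in lborel. (\<lambda>n. K u * g n (y + H n * u)) \<longlonglongrightarrow> K u * g' (y + h * u)"
    using lim by (intro AE_I2 tendsto_intros)
qed (use g in \<open>auto simp: abs_mult mult_left_le\<close>)

lemma expectation_tendsto:
  fixes Z :: "nat \<Rightarrow> real \<Rightarrow> real"
  assumes [measurable]: "\<And>n. Z n \<in> borel_measurable borel" "Z' \<in> borel_measurable borel"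
    and "\<And>n y. \<bar>Z n y\<bar> \<le> A" "\<And>y. (\<lambda>n. Z n y) \<longlonglongrightarrow> Z' y"
  shows "(\<lambda>n. expectation (Z n)) \<longlonglongrightarrow> expectation Z'"
  by (rule integral_dominated_convergence[where w = "\<lambda>_. A"]) (use assms in auto)

lemma variance_tendsto:
  fixes Z :: "nat \<Rightarrow> real \<Rightarrow> real"
  assumes m [measurable]: "\<And>n. Z n \<in> borel_measurable borel" "Z' \<in> borel_measurable borel"
    and b: "\<And>n y. \<bar>Z n y\<bar> \<le> A" and l: "\<And>y. (\<lambda>n. Z n y) \<longlonglongrightarrow> Z' y"
  shows "(\<lambda>n. expectation (\<lambda>y. (Z n y - expectation (Z n))\<^sup>2))
    \<longlonglongrightarrow> expectation (\<lambda>y. (Z' y - expectation Z')\<^sup>2)"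
proof (rule expectation_tendsto)
  fix n y
  have "\<bar>expectation (Z n)\<bar> \<le> A"
    using b by (intro order_trans[OF integral_abs_bound] integral_le_const)
      (auto intro!: integrable_bounded[of _ A])
  then have "\<bar>Z n y - expectation (Z n)\<bar> \<le> 2 * A"
    using b[of n y] by linarith
  then show "\<bar>(Z n y - expectation (Z n))\<^sup>2\<bar> \<le> (2 * A)\<^sup>2"
    unfolding power_abs by (intro power_mono) auto
next
  show "(\<lambda>n. (Z n y - expectation (Z n))\<^sup>2) \<longlonglongrightarrow> (Z' y - expectation Z')\<^sup>2" for y
    by (intro tendsto_intros l expectation_tendsto[OF m b l])
qed auto

text \<open>\<open>Suc n\<close> avoids a division by 0, which would make the cutoff for
  \<open>n = 0\<close> constantly 1.\<close>

definition tent :: "nat \<Rightarrow> real \<Rightarrow> real" where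
  "tent n x = max 0 (1 - \<bar>x\<bar> / real (Suc n))"

lemma continuous_on_tent: "continuous_on UNIV (tent n)"
  unfolding tent_def[abs_def] by (intro continuous_intros) auto

lemma tent_bounds: "0 \<le> tent n x" "tent n x \<le> 1"
  by (auto simp: tent_def)

lemma tent_tendsto: "(\<lambda>n. tent n x) \<longlonglongrightarrow> 1"
proof -
  have "(\<lambda>n. max 0 (1 - \<bar>x\<bar> * inverse (real (Suc n)))) \<longlonglongrightarrow> max 0 (1 - \<bar>x\<bar> * 0)"
    by (intro tendsto_intros LIMSEQ_inverse_real_of_nat)
  then show ?thesis by (simp add: tent_def[abs_def] divide_inverse)
qed

text \<open>A test function need only be continuous and bounded: the square integrability demanded by
  the pairing estimates is removed by multiplying with the tent functions.\<close>

context
  fixes H :: "nat \<Rightarrow> real" and h :: real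
  assumes H_pos: "\<And>n. 0 < H n" and h_pos: "0 < h" and H_lim: "H \<longlonglongrightarrow> h"
begin

context
  fixes g :: "real \<Rightarrow> real"
  assumes g_cont: "continuous_on UNIV g" and g_bounded: "\<And>x. \<bar>g x\<bar> \<le> 1"
begin

lemma g_measurable [measurable]: "g \<in> borel_measurable borel"
  using g_cont by (rule borel_measurable_continuous_onI)

lemma kernel_mean_bandwidth_tendsto: "(\<lambda>n. kernel_mean g (H n) y) \<longlonglongrightarrow> kernel_mean g h y"
proof (rule kernel_mean_tendsto)
  have "isCont g z" for z
    using g_cont continuous_on_eq_continuous_at[of UNIV g] by simp
  then show "(\<lambda>n. g (y + H n * u)) \<longlonglongrightarrow> g (y + h * u)" for u
    by (rule isCont_tendsto_compose) (intro tendsto_intros H_lim)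
qed (use g_bounded in auto)

lemma kernel_mean_expectation_tendsto:
  "(\<lambda>n. expectation (kernel_mean g (H n))) \<longlonglongrightarrow> expectation (kernel_mean g h)"
  by (rule expectation_tendsto[where A = "\<integral>u. \<bar>K u\<bar> \<partial>lborel"])
    (auto intro!: kernel_mean_bandwidth_tendsto kernel_mean_bounded g_bounded)

lemma kernel_mean_variance_tendsto:
  "(\<lambda>n. expectation (\<lambda>y. (kernel_mean g (H n) y - expectation (kernel_mean g (H n)))\<^sup>2))
    \<longlonglongrightarrow> expectation (\<lambda>y. (kernel_mean g h y - expectation (kernel_mean g h))\<^sup>2)"
  by (rule variance_tendsto[where A = "\<integral>u. \<bar>K u\<bar> \<partial>lborel"])
    (auto intro!: kernel_mean_bandwidth_tendsto kernel_mean_bounded g_bounded)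

context
  assumes g_sq: "integrable lborel (\<lambda>x. (g x)\<^sup>2)"
begin

text \<open>The pairing estimate bounds the squared difference at \<open>H n\<close> by a null
  sequence, while dominated convergence identifies its limit at \<open>h\<close>.\<close>

lemma sq_integrable_kernel_mean_expectation:
  assumes bias: "(\<lambda>n. bias_at (H n)) \<longlonglongrightarrow> 0"
  shows "expectation (kernel_mean g h) = expectation g"
proof -
  let ?d = "\<lambda>n. (expectation (kernel_mean g (H n)) - expectation g)\<^sup>2"
  have "?d n \<le> bias_at (H n) * roughness g" for n
  proof -
    obtain B where "smoothed_distribution \<mu> (scaled_kernel K (H n)) B"
      using smoothed_distribution_at H_pos .
    then interpret S: smoothed_distribution \<mu> "scaled_kernel K (H n)" B .
    show ?thesis
      using S.paired_sq_error_le[OF g_measurable g_bounded g_sq f_measurable f_sq_integrable]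
      by (simp add: paired_scaled_kernel H_pos expectation_eq)
  qed
  moreover have "(\<lambda>n. bias_at (H n) * roughness g) \<longlonglongrightarrow> 0"
    using tendsto_mult_left_zero[OF bias] by simp
  ultimately have "?d \<longlonglongrightarrow> 0"
    by (intro tendsto_sandwich[of "\<lambda>_. 0" ?d sequentially]) auto
  moreover have "?d \<longlonglongrightarrow> (expectation (kernel_mean g h) - expectation g)\<^sup>2"
    by (intro tendsto_intros kernel_mean_expectation_tendsto)
  ultimately have "(expectation (kernel_mean g h) - expectation g)\<^sup>2 = 0"
    using LIMSEQ_unique by blast
  then show ?thesis by simp
qed

lemma sq_integrable_kernel_mean_variance:
  assumes var: "(\<lambda>n. variance_at (H n)) \<longlonglongrightarrow> 0"
  shows "expectation (\<lambda>y. (kernel_mean g h y - expectation (kernel_mean g h))\<^sup>2) = 0"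
proof -
  let ?d = "\<lambda>n. expectation (\<lambda>y. (kernel_mean g (H n) y - expectation (kernel_mean g (H n)))\<^sup>2)"
  have "?d n \<le> variance_at (H n) * roughness g" for n
  proof -
    obtain B where "smoothed_distribution \<mu> (scaled_kernel K (H n)) B"
      using smoothed_distribution_at H_pos .
    then interpret S: smoothed_distribution \<mu> "scaled_kernel K (H n)" B .
    show ?thesis
      using S.paired_variance_le[OF g_measurable g_bounded g_sq]
      by (simp add: paired_scaled_kernel H_pos)
  qed
  moreover have "(\<lambda>n. variance_at (H n) * roughness g) \<longlonglongrightarrow> 0"
    using tendsto_mult_left_zero[OF var] by simp
  ultimately have "?d \<longlonglongrightarrow> 0"
    by (intro tendsto_sandwich[of "\<lambda>_. 0" ?d sequentially]) auto
  then show ?thesis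
    using LIMSEQ_unique kernel_mean_variance_tendsto by blast
qed

end

lemma mult_tent_continuous: "continuous_on UNIV (\<lambda>x. g x * tent n x)"
  by (intro continuous_intros g_cont continuous_on_tent)

lemma mult_tent_measurable [measurable]: "(\<lambda>x. g x * tent n x) \<in> borel_measurable borel"
  by (rule borel_measurable_continuous_onI[OF mult_tent_continuous])

lemma mult_tent_sq_integrable: "integrable lborel (\<lambda>x. (g x * tent n x)\<^sup>2)"
proof (rule Bochner_Integration.integrable_bound)
  show "integrable lborel (indicator {- real (Suc n)..real (Suc n)} :: real \<Rightarrow> real)"
    by simp
  have "(g x * tent n x)\<^sup>2 \<le> indicator {- real (Suc n)..real (Suc n)} x" for x
  proof (cases "\<bar>x\<bar> \<le> real (Suc n)")
    case True
    have "\<bar>g x * tent n x\<bar> \<le> 1"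
      using mult_mono[OF g_bounded[of x], of "\<bar>tent n x\<bar>" 1] tent_bounds[of n x] by (simp add: abs_mult)
    then show ?thesis using True by (simp add: abs_le_square_iff[symmetric] indicator_def abs_square_le_1 abs_le_iff)
  next
    case False
    then have "tent n x = 0" by (simp add: tent_def field_simps)
    then show ?thesis by simp
  qed
  then show "AE x in lborel. norm ((g x * tent n x)\<^sup>2) \<le> norm (indicator {- real (Suc n)..real (Suc n)} x :: real)"
    by simp
qed simp

lemma mult_tent_tendsto: "(\<lambda>n. g x * tent n x) \<longlonglongrightarrow> g x"
  using tendsto_mult_left[OF tent_tendsto, of "g x"] by simp

lemma mult_tent_bounded: "\<bar>g x * tent n x\<bar> \<le> 1"
  using mult_mono[OF g_bounded[of x], of "\<bar>tent n x\<bar>" 1] tent_bounds[of n x] by (simp add: abs_mult)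

lemma kernel_mean_mult_tent_tendsto:
  "(\<lambda>n. kernel_mean (\<lambda>x. g x * tent n x) h y) \<longlonglongrightarrow> kernel_mean g h y"
  by (rule kernel_mean_tendsto) (auto intro: mult_tent_bounded mult_tent_tendsto)

end

text \<open>The bandwidth limit is taken first, for each fixed cutoff, and the cutoff is removed
  afterwards at \<open>h\<close>: the norm of the truncated function enters the pairing estimate and
  may grow with \<open>n\<close>.\<close>

lemma kernel_mean_expectation:
  assumes cont: "continuous_on UNIV g" and bd: "\<And>x. \<bar>g x\<bar> \<le> 1"
    and bias: "(\<lambda>n. bias_at (H n)) \<longlonglongrightarrow> 0"
  shows "expectation (kernel_mean g h) = expectation g"
proof -
  note [measurable] = g_measurable[OF cont bd] mult_tent_measurable[OF cont bd]
  have "(\<lambda>n. expectation (kernel_mean (\<lambda>x. g x * tent n x) h)) \<longlonglongrightarrow> expectation (kernel_mean g h)"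
    by (rule expectation_tendsto[where A = "\<integral>u. \<bar>K u\<bar> \<partial>lborel"])
      (auto intro!: kernel_mean_mult_tent_tendsto kernel_mean_bounded mult_tent_bounded cont bd)
  moreover have "(\<lambda>n. expectation (\<lambda>x. g x * tent n x)) \<longlonglongrightarrow> expectation g"
    by (rule expectation_tendsto[where A = 1])
      (auto intro!: mult_tent_tendsto mult_tent_bounded cont bd)
  moreover have "expectation (kernel_mean (\<lambda>x. g x * tent n x) h) = expectation (\<lambda>x. g x * tent n x)" for n
    by (rule sq_integrable_kernel_mean_expectation)
      (intro mult_tent_continuous mult_tent_bounded mult_tent_sq_integrable cont bd bias)+
  ultimately show ?thesis
    by (simp add: LIMSEQ_unique)
qed

lemma kernel_mean_variance:
  assumes cont: "continuous_on UNIV g" and bd: "\<And>x. \<bar>g x\<bar> \<le> 1"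
    and var: "(\<lambda>n. variance_at (H n)) \<longlonglongrightarrow> 0"
  shows "expectation (\<lambda>y. (kernel_mean g h y - expectation (kernel_mean g h))\<^sup>2) = 0"
proof -
  note [measurable] = g_measurable[OF cont bd] mult_tent_measurable[OF cont bd]
  let ?Z = "\<lambda>n. kernel_mean (\<lambda>x. g x * tent n x) h"
  have "(\<lambda>n. expectation (\<lambda>y. (?Z n y - expectation (?Z n))\<^sup>2))
      \<longlonglongrightarrow> expectation (\<lambda>y. (kernel_mean g h y - expectation (kernel_mean g h))\<^sup>2)"
    by (rule variance_tendsto[where A = "\<integral>u. \<bar>K u\<bar> \<partial>lborel"])
      (auto intro!: kernel_mean_mult_tent_tendsto kernel_mean_bounded mult_tent_bounded cont bd)
  moreover have "expectation (\<lambda>y. (?Z n y - expectation (?Z n))\<^sup>2) = 0" for n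
    by (rule sq_integrable_kernel_mean_variance)
      (intro mult_tent_continuous mult_tent_bounded mult_tent_sq_integrable cont bd var)+
  ultimately show ?thesis
    by (simp add: LIMSEQ_const_iff)
qed

lemma kernel_mean_AE_const:
  assumes cont: "continuous_on UNIV g" and bd: "\<And>x. \<bar>g x\<bar> \<le> 1"
    and var: "(\<lambda>n. variance_at (H n)) \<longlonglongrightarrow> 0"
  shows "AE y in \<mu>. kernel_mean g h y = expectation (kernel_mean g h)"
proof -
  note [measurable] = g_measurable[OF cont bd]
  let ?A = "\<integral>u. \<bar>K u\<bar> \<partial>lborel"
  have "\<bar>kernel_mean g h y - expectation (kernel_mean g h)\<bar> \<le> ?A + \<bar>expectation (kernel_mean g h)\<bar>" for y
    using kernel_mean_bounded[OF g_measurable[OF cont bd] bd, of h y] by linarith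
  then have "integrable \<mu> (\<lambda>y. (kernel_mean g h y - expectation (kernel_mean g h))\<^sup>2)"
    by (intro integrable_bounded[of _ "(?A + \<bar>expectation (kernel_mean g h)\<bar>)\<^sup>2"])
      (auto simp: abs_le_square_iff[symmetric] intro: order_trans[OF _ abs_ge_self])
  then have "AE y in \<mu>. (kernel_mean g h y - expectation (kernel_mean g h))\<^sup>2 = 0"
    using kernel_mean_variance[OF assms] by (subst (asm) integral_nonneg_eq_0_iff_AE) auto
  then show ?thesis by simp
qed

end

section \<open>Trigonometric test functions\<close>

lemma kernel_mean_cos_sin:
  "Complex (kernel_mean (\<lambda>x. cos (t * x)) h y) (kernel_mean (\<lambda>x. sin (t * x)) h y)
    = cis (t * y) * fourier K (h * t)"
proof -
  \<comment> \<open>Characters are eigenfunctions of the averaging: a shift by \<open>h * u\<close>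
    multiplies \<open>cis (t * y)\<close> by a phase.\<close>
  have "cis (t * y) * cis (h * t * u) = cis (t * (y + h * u))" for u
    unfolding cis_mult by (simp add: algebra_simps)
  then have mult: "cis (t * y) * (cis (h * t * u) * complex_of_real (K u)) = complex_of_real (K u) * cis (t * (y + h * u))" for u
    by (metis mult.assoc mult.commute)
  have "cis (t * y) * fourier K (h * t) = (\<integral>u. cis (t * y) * (cis (h * t * u) * complex_of_real (K u)) \<partial>lborel)"
    by (simp add: fourier_def)
  also have "\<dots> = (\<integral>u. complex_of_real (K u) * cis (t * (y + h * u)) \<partial>lborel)"
    unfolding mult ..
  finally have *: "cis (t * y) * fourier K (h * t) = (\<integral>u. complex_of_real (K u) * cis (t * (y + h * u)) \<partial>lborel)" .
  have "integrable lborel (\<lambda>u. complex_of_real (K u) * cis (t * (y + h * u)))"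
    by (rule Bochner_Integration.integrable_bound[OF K_integrable]) (auto simp: norm_mult)
  then show ?thesis
    unfolding * kernel_mean_def
    by (simp add: complex_eq_iff flip: Bochner_Integration.integral_Re Bochner_Integration.integral_Im)
qed

text \<open>Integrating the eigenfunction formula over \<mu> gives the left side; the limit of small
  biases leaves the means of cosine and sine unchanged by the kernel.\<close>

lemma fourier_eq_of_bias_tendsto_0:
  assumes "\<And>n. 0 < H n" "0 < h" "H \<longlonglongrightarrow> h" "(\<lambda>n. bias_at (H n)) \<longlonglongrightarrow> 0"
  shows "fourier K (h * t) * fourier f t = fourier f t"
proof -
  let ?c = "\<lambda>x. cos (t * x)" and ?s = "\<lambda>x. sin (t * x)"
  have int: "integrable \<mu> (kernel_mean g h)" if "g \<in> borel_measurable borel" "\<And>x. \<bar>g x\<bar> \<le> 1" for g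
    by (rule integrable_bounded[of _ "\<integral>u. \<bar>K u\<bar> \<partial>lborel"]) (use kernel_mean_bounded[OF that] that in auto)
  have c: "expectation (kernel_mean ?c h) = expectation ?c"
    by (rule kernel_mean_expectation[OF assms(1-3)]) (auto intro!: continuous_intros assms(4))
  have s: "expectation (kernel_mean ?s h) = expectation ?s"
    by (rule kernel_mean_expectation[OF assms(1-3)]) (auto intro!: continuous_intros assms(4))
  have "fourier K (h * t) * fourier f t = (\<integral>y. cis (t * y) * fourier K (h * t) \<partial>\<mu>)"
    by (simp add: char_\<mu>[symmetric] char_def cis_conv_exp)
  also have "\<dots> = (\<integral>y. complex_of_real (kernel_mean ?c h y) + \<i> * complex_of_real (kernel_mean ?s h y) \<partial>\<mu>)"
    by (simp add: kernel_mean_cos_sin[symmetric] Complex_eq)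
  also have "\<dots> = complex_of_real (expectation ?c) + \<i> * complex_of_real (expectation ?s)"
    using int[of ?c] int[of ?s] by (simp add: c s)
  also have "\<dots> = (\<integral>y. complex_of_real (?c y) + \<i> * complex_of_real (?s y) \<partial>\<mu>)"
    using integrable_bounded[of ?c 1] integrable_bounded[of ?s 1] by simp
  also have "\<dots> = fourier f t"
    unfolding char_\<mu>[symmetric] char_def cis_conv_exp[symmetric] by (simp add: cis.code Complex_eq)
  finally show ?thesis .
qed

lemma fourier_eventually_nonzero:
  assumes "integrable lborel g" "integral\<^sup>L lborel g = 1"
  obtains e where "0 < e" "\<And>t. \<bar>t\<bar> < e \<Longrightarrow> fourier g t \<noteq> 0"
proof -
  have "fourier g 0 = 1" using assms(2) by (simp add: fourier_def)
  then show thesis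
    using continuous_at_avoid[OF isCont_fourier[OF assms(1)], of 0 0] that
    by (auto simp: dist_real_def)
qed

text \<open>A vanishing limit would make the kernel means of cosine and sine almost surely constant.
  After division by a nonzero value of the transform of \<open>K\<close>, so would be
  \<open>cis (t * y)\<close>.\<close>

lemma not_variance_tendsto_0:
  assumes "\<And>n. 0 < H n" "0 < h" "H \<longlonglongrightarrow> h"
  shows "\<not> (\<lambda>n. variance_at (H n)) \<longlonglongrightarrow> 0"
proof
  assume var: "(\<lambda>n. variance_at (H n)) \<longlonglongrightarrow> 0"
  obtain e where e: "0 < e" "\<And>t. \<bar>t\<bar> < e \<Longrightarrow> fourier K t \<noteq> 0"
    using fourier_eventually_nonzero[OF K_integrable K_integral] by blast
  \<comment> \<open>This puts \<open>h * t = e / 2\<close> inside the neighbourhood where the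
    transform of \<open>K\<close> is nonzero.\<close>
  define t where "t = e / (2 * h)"
  have t: "t \<noteq> 0" and K0: "fourier K (h * t) \<noteq> 0"
    using e assms(2) by (auto simp: t_def)
  let ?c = "\<lambda>x. cos (t * x)" and ?s = "\<lambda>x. sin (t * x)"
  define w where "w = Complex (expectation (kernel_mean ?c h)) (expectation (kernel_mean ?s h)) / fourier K (h * t)"
  have "AE y in \<mu>. kernel_mean ?c h y = expectation (kernel_mean ?c h)"
    by (rule kernel_mean_AE_const[OF assms]) (auto intro!: continuous_intros var)
  moreover have "AE y in \<mu>. kernel_mean ?s h y = expectation (kernel_mean ?s h)"
    by (rule kernel_mean_AE_const[OF assms]) (auto intro!: continuous_intros var)
  ultimately have "AE y in \<mu>. cis (t * y) = w"
  proof eventually_elim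
    case (elim y)
    have "cis (t * y) * fourier K (h * t) = w * fourier K (h * t)"
      using K0 by (simp only: kernel_mean_cos_sin[symmetric] elim) (simp add: w_def)
    then show ?case using K0 by simp
  qed
  \<comment> \<open>Almost every point with positive density lies in a countable level set, so
    \<open>f\<close> would vanish almost everywhere.\<close>
  then have "AE y in lborel. 0 < f y \<longrightarrow> cis (t * y) = w"
    by (simp add: AE_density)
  moreover have "AE y in lborel. y \<notin> {y. cis (t * y) = w}"
    using countable_cis_level_set[OF t] by (intro AE_not_in countable_imp_null_set_lborel)
  ultimately have "AE y in lborel. f y = 0"
  proof eventually_elim
    case (elim y)
    then show ?case using f_nonneg[of y] by auto
  qed
  then have "integral\<^sup>L lborel f = 0"
    by (rule integral_eq_zero_AE)
  then show False using f_integral by simp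
qed

text \<open>Compactness: otherwise variances and biases tend to 0 together along a sequence, and a
  subsequence of its bandwidths has a positive limit, along which the variances cannot tend to
  0.\<close>

lemma risk_bounded_below:
  obtains c where "0 < c" "\<And>h. 0 < h \<Longrightarrow> c \<le> variance_at h + bias_at h"
proof (rule ccontr)
  assume "\<not> thesis"
  with that have "\<exists>h>0. variance_at h + bias_at h < c" if "0 < c" for c
    using that by (meson not_le)
  then have "\<forall>k::nat. \<exists>h>0. variance_at h + bias_at h < inverse (real (Suc k))"
    by simp
  then obtain H where H: "\<And>k. 0 < H k" "\<And>k. variance_at (H k) + bias_at (H k) < inverse (real (Suc k))"
    by metis
  have le: "variance_at (H k) \<le> inverse (real (Suc k))" "bias_at (H k) \<le> inverse (real (Suc k))" for k
    using H(2)[of k] variance_at_nonneg[OF H(1)[of k]] bias_at_nonneg[OF H(1)[of k]] by linarith+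
  have v: "(\<lambda>k. variance_at (H k)) \<longlonglongrightarrow> 0" and b: "(\<lambda>k. bias_at (H k)) \<longlonglongrightarrow> 0"
    using le H(1) variance_at_nonneg bias_at_nonneg
    by (auto intro!: tendsto_sandwich[OF _ _ tendsto_const LIMSEQ_inverse_real_of_nat])
  have "variance_at (H k) \<le> 1" for k
    using le(1)[of k] by (rule order_trans) (simp add: inverse_le_1_iff)
  then obtain h r where hr: "0 < h" "strict_mono (r :: nat \<Rightarrow> nat)" "(\<lambda>k. H (r k)) \<longlonglongrightarrow> h"
    using convergent_bandwidths[OF H(1) b] by blast
  show False
    using not_variance_tendsto_0[OF H(1) hr(1,3)] LIMSEQ_subseq_LIMSEQ[OF v hr(2)] by (simp add: o_def)
qed

section \<open>The two implications\<close>

lemma Phi_le: "0 < h \<Longrightarrow> Phi n f K \<le> MISE n f K h"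
  unfolding Phi_def by (rule INF_lower) simp

text \<open>Near-optimal bandwidths have bounded variance and bias tending to 0 as the sample size
  grows; the identity holds at a limit point of them.\<close>

lemma transform_identity_of_exact_order:
  assumes "exact_order_inv_n (\<lambda>n. Phi n f K)"
  obtains h where "0 < h" "\<And>t. fourier K (h * t) * fourier f t = fourier f t"
proof -
  obtain C n0 where C: "0 < C" and Phi: "\<And>n. n \<ge> n0 \<Longrightarrow> Phi n f K \<le> ennreal (C / real n)"
    using assms unfolding exact_order_inv_n_def by (meson order_less_le_trans)
  \<comment> \<open>These sample sizes are positive, at least \<open>n0\<close>, and at least
    \<open>Suc k\<close>, which gives the rate below.\<close>
  let ?n = "\<lambda>k. Suc (k + n0)"
  have "\<exists>h>0. variance_at h \<le> C + 1 \<and> bias_at h \<le> (C + 1) * inverse (real (Suc k))" for k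
  proof -
    \<comment> \<open>Passing from \<open>C\<close> to \<open>C + 1\<close> makes the inequality
      strict, so that some bandwidth lies below the bound even if the infimum is not
      attained.\<close>
    have "Phi (?n k) f K < ennreal ((C + 1) / real (?n k))"
      using Phi[of "?n k"] C by (auto elim!: order_le_less_trans intro!: ennreal_lessI divide_strict_right_mono)
    then obtain h where h: "0 < h" and "MISE (?n k) f K h < ennreal ((C + 1) / real (?n k))"
      unfolding Phi_def INF_less_iff by auto
    then have le: "variance_at h / real (?n k) + bias_at h \<le> (C + 1) / real (?n k)"
      unfolding MISE_eq[OF h zero_less_Suc] by (meson ennreal_leI leD nle_le)
    then have "variance_at h / real (?n k) \<le> (C + 1) / real (?n k)"
      using bias_at_nonneg[OF h] by linarith
    then have "variance_at h \<le> C + 1"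
      by (simp add: divide_le_cancel)
    moreover have "bias_at h \<le> (C + 1) / real (?n k)"
      using le divide_nonneg_nonneg[OF variance_at_nonneg[OF h], of "real (?n k)"] by linarith
    then have "bias_at h \<le> (C + 1) * inverse (real (Suc k))"
      using C by (elim order_trans) (auto simp: divide_inverse intro!: mult_left_mono le_imp_inverse_le)
    ultimately show ?thesis using h by blast
  qed
  then obtain H where H: "\<And>k. 0 < H k" "\<And>k. variance_at (H k) \<le> C + 1"
    "\<And>k. bias_at (H k) \<le> (C + 1) * inverse (real (Suc k))"
    by metis
  have upper: "(\<lambda>k. (C + 1) * inverse (real (Suc k))) \<longlonglongrightarrow> 0"
    using tendsto_mult_right_zero[OF LIMSEQ_inverse_real_of_nat] by simp
  have b: "(\<lambda>k. bias_at (H k)) \<longlonglongrightarrow> 0"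
    by (rule tendsto_sandwich[OF _ _ tendsto_const upper]) (simp_all only: H bias_at_nonneg eventually_True)
  obtain h r where hr: "0 < h" "strict_mono (r :: nat \<Rightarrow> nat)" "(\<lambda>k. H (r k)) \<longlonglongrightarrow> h"
    using convergent_bandwidths[OF H(1) b H(2)] by blast
  show thesis
  proof (rule that[OF hr(1)])
    show "fourier K (h * t) * fourier f t = fourier f t" for t
      using fourier_eq_of_bias_tendsto_0[OF H(1) hr(1,3)] LIMSEQ_subseq_LIMSEQ[OF b hr(2)]
      by (simp add: o_def)
  qed
qed

text \<open>Near 0 the transform of \<open>f\<close> is nonzero and cancels, leaving the transform
  of \<open>K\<close> equal to 1 on \<open>[0, h * e)\<close>.\<close>

lemma S_K_pos_of_transform_identity:
  assumes h: "0 < h" and F: "\<And>t. fourier K (h * t) * fourier f t = fourier f t"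
  shows "0 < S_K K"
proof -
  obtain e where e: "0 < e" "\<And>t. \<bar>t\<bar> < e \<Longrightarrow> fourier f t \<noteq> 0"
    using fourier_eventually_nonzero[OF f_integrable f_integral] by blast
  have "h * e \<le> t" if t: "0 \<le> t" "fourier K t \<noteq> 1" for t
  proof (rule ccontr)
    assume "\<not> h * e \<le> t"
    then have "\<bar>t / h\<bar> < e" using t h by (simp add: field_simps)
    then have "fourier K t = 1"
      using F[of "t / h"] e(2)[of "t / h"] h by simp
    then show False using t by simp
  qed
  then have "ereal (h * e) \<le> S_K K"
    unfolding S_K_def by (intro Inf_greatest) auto
  then show ?thesis
    using h e(1) by (meson ereal_less(2) less_le_trans mult_pos_pos)
qed

text \<open>Beyond some \<open>r\<close> the transform of \<open>K\<close> differs from 1 almost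
  everywhere. If that of \<open>f\<close> were nonzero at some \<open>s > r / h\<close>, continuity
  would make it nonzero nearby, forcing the transform of \<open>K\<close> to be 1 on an interval
  beyond \<open>r\<close>.\<close>

lemma D_f_finite_of_transform_identity:
  assumes h: "0 < h" and F: "\<And>t. fourier K (h * t) * fourier f t = fourier f t" and ST: "S_K K = T_K K"
  shows "D_f f < \<infinity>"
proof -
  obtain t0 where "0 \<le> t0" "fourier K t0 \<noteq> 1" using fourier_K_neq_1 by blast
  then have "S_K K \<le> ereal t0"
    unfolding S_K_def by (intro Inf_lower) auto
  \<comment> \<open>The assumed equality carries finiteness from \<open>S_K\<close> to
    \<open>T_K\<close>.\<close>
  then have "T_K K < \<infinity>" using ST by auto
  then obtain r where r: "0 \<le> r" "AE t in lborel. r \<le> t \<longrightarrow> fourier K t \<noteq> 1"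
    unfolding T_K_def Inf_less_iff by auto
  have zero: "fourier f s = 0" if s: "r / h < s" for s
  proof (rule ccontr)
    assume "fourier f s \<noteq> 0"
    then obtain e where e: "0 < e" "\<And>y. dist s y < e \<Longrightarrow> fourier f y \<noteq> 0"
      using continuous_at_avoid[OF isCont_fourier[OF f_integrable]] by blast
    \<comment> \<open>The interval extends only to the right of \<open>h * s\<close>, so its points
      stay above \<open>r\<close>.\<close>
    have "AE t in lborel. t \<notin> {h * s..<h * s + h * e}"
      using r(2)
    proof eventually_elim
      case (elim t)
      show ?case
      proof
        assume t: "t \<in> {h * s..<h * s + h * e}"
        then have "dist s (t / h) < e"
          using h by (simp add: dist_real_def field_simps abs_if)
        then have "fourier K t = 1"
          using F[of "t / h"] e(2)[of "t / h"] h by simp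
        moreover have "r \<le> t" using s t h by (simp add: field_simps)
        ultimately show False using elim by simp
      qed
    qed
    then have "emeasure lborel {h * s..<h * s + h * e} = 0"
      by (subst (asm) AE_iff_measurable[of "{h * s..<h * s + h * e}"]) auto
    then show False using h e(1) by simp
  qed
  have "t \<le> r / h" if "fourier f t \<noteq> 0" for t
    using zero[of t] that by (meson not_le)
  then have "D_f f \<le> ereal (r / h)"
    unfolding D_f_def by (intro Sup_least) auto
  then show ?thesis by auto
qed

text \<open>The zero-bias bandwidth gives the upper constant \<open>variance_at h\<close>; the lower
  one is the bound on variance plus bias over all bandwidths.\<close>

lemma exact_order_of_unbiased:
  assumes h: "0 < h" and bias: "bias_at h = 0"
  shows "exact_order_inv_n (\<lambda>n. Phi n f K)"
proof -
  obtain c where c: "0 < c" "\<And>h. 0 < h \<Longrightarrow> c \<le> variance_at h + bias_at h"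
    using risk_bounded_below by blast
  show ?thesis
    unfolding exact_order_inv_n_def
  proof (intro exI conjI allI impI)
    show "0 < c" by (rule c)
    show "c \<le> variance_at h" using c(2)[OF h] bias by simp
    fix n :: nat
    \<comment> \<open>This fixes \<open>n0 = 1\<close>. For such \<open>n\<close>, dividing the bias
      by \<open>n\<close> does not increase it, so the bound on variance plus bias may be divided by
      \<open>n\<close>.\<close>
    assume n: "1 \<le> n"
    have "c / real n \<le> variance_at h / real n + bias_at h" if "0 < h" for h
    proof -
      have "bias_at h / real n \<le> bias_at h"
        using mult_left_mono[of 1 "real n" "bias_at h"] bias_at_nonneg[OF that] n
        by (simp add: divide_le_eq)
      then show ?thesis
        using divide_right_mono[OF c(2)[OF that], of "real n"] by (simp add: add_divide_distrib)
    qed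
    then show "ennreal (c / real n) \<le> Phi n f K"
      unfolding Phi_def using n by (intro INF_greatest) (auto simp: MISE_eq intro!: ennreal_leI)
    show "Phi n f K \<le> ennreal (variance_at h / real n)"
      using Phi_le[OF h, of n] MISE_eq[OF h, of n] n bias by simp
  qed
qed

text \<open>With \<open>h = s / d\<close>, each \<open>t \<ge> 0\<close> where the transform of
  \<open>f\<close> is nonzero satisfies \<open>h * t \<le> s\<close>, and there the transform of
  \<open>K\<close> is 1.\<close>

lemma unbiased_bandwidth:
  assumes S: "0 < S_K K" and D: "D_f f < \<infinity>"
  obtains h where "0 < h" "bias_at h = 0"
proof -
  obtain s where s: "0 < s" "ereal s < S_K K"
    using ereal_dense2[OF S] by (auto simp: zero_ereal_def)
  have K1: "fourier K t = 1" if "0 \<le> t" "t \<le> s" for t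
  proof (rule ccontr)
    assume "fourier K t \<noteq> 1"
    then have "S_K K \<le> ereal t"
      unfolding S_K_def using that by (intro Inf_lower) auto
    also have "\<dots> \<le> ereal s" using that by simp
    finally show False using s by simp
  qed
  obtain d where d: "D_f f \<le> ereal d" "0 < d"
  proof (cases "D_f f")
    case (real x)
    \<comment> \<open>The maximum with 1 keeps the divisor \<open>d\<close> positive.\<close>
    then show thesis using that[of "max x 1"] by simp
  qed (use D that[of 1] in auto)
  have f0: "t \<le> d" if "0 \<le> t" "fourier f t \<noteq> 0" for t
  proof -
    have "ereal t \<le> D_f f"
      unfolding D_f_def using that by (intro Sup_upper) auto
    then show ?thesis using d(1) order_trans by fastforce
  qed
  show thesis
  proof (rule that)
    show h: "0 < s / d" using s d by simp
    show "bias_at (s / d) = 0"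
    proof (rule bias_at_eq_0[OF h])
      fix t :: real
      assume t: "0 \<le> t"
      show "fourier K (s / d * t) * fourier f t = fourier f t"
      proof (cases "fourier f t = 0")
        case False
        then have "s / d * t \<le> s"
          using f0[OF t] s d by (simp add: divide_le_eq mult_left_mono)
        then show ?thesis
          using K1[of "s / d * t"] t s d by simp
      qed simp
    qed
  qed
qed

end

theorem theorem4:
  fixes K f :: "real \<Rightarrow> real"
  assumes "is_kernel K"
    and "S_K K = T_K K"
    and "is_density f"
    and "integrable lborel (\<lambda>x. (f x)\<^sup>2)"
  shows "exact_order_inv_n (\<lambda>n. Phi n f K) \<longleftrightarrow> (S_K K > 0 \<and> D_f f < \<infinity>)"
proof -
  interpret kernel_density_estimation K f
    using assms by unfold_locales
  \<comment> \<open>Both directions pass through one bandwidth: a limit of near-optimal ones for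
    necessity, one of zero bias for sufficiency.\<close>
  show ?thesis
    using transform_identity_of_exact_order S_K_pos_of_transform_identity
      D_f_finite_of_transform_identity[OF _ _ assms(2)] unbiased_bandwidth exact_order_of_unbiased
    by metis
qed

end
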